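(* Consider the problem of minimizing $\phi(x)=\mathbb{E}_\xi[F(x,\xi)]+\Psi(x)$ over $x\in\mathbb{R}^n$, and write $f(x)=\mathbb{E}_\xi[F(x,\xi)]$. Assume that: the set $X^\star$ of minimizers of $\phi$ is nonempty, with $\phi^\star$ the optimal value; for each $\xi\in\Xi$, $\|\nabla_xF(y,\xi)-\nabla_xF(z,\xi)\|_*\le L\|y-z\|$ for all $y,z\in\mathbb{R}^n$; there is a constant $\sigma\ge 0$ such that $\mathbb{E}_\xi[\|\nabla_xF(x,\xi)-\nabla f(x)\|_*^2]\le\sigma^2$ for all $x\in\mathbb{R}^n$; and $\Psi$ is simple (a term used informally) and lower semicontinuous, with closed effective domain. Let $\{x(k)\}_{k\ge 0}$ be the iterates of the asynchronous mini-batch algorithm described in the context, with batch size $b$, delays bounded by $\tau_{\max}$, and constant step-size $$\gamma(k)=\gamma\in\left(0,\frac{1}{L(\tau_{\max}+1)^2}\right)\quad\text{for all }k\in\mathbb{N}_0.$$ Then for every $T\in\mathbb{N}$ and every $x^\star\in X^\star$, $$\mathbb{E}\bigl[\phi(x_{\mathrm{ave}}(T))\bigr]-\phi^\star\le\frac{D_\omega(x(0),x^\star)}{\gamma T}+\frac{\gamma c\sigma^2}{2b\bigl(1-\gamma L(\tau_{\max}+1)^2\bigr)},$$ where $x_{\mathrm{ave}}(T)=\frac1T\sum_{k=1}^Tx(k)$ is the Cesàro average of the iterates, $b$ is the batch size, the expectation is taken with respect to all random variables $\{\xi_i(k): i=1,\dots,b,\ k=0,\dots,T-1\}$, and $c\in[1,b]$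 is given by $c=1$ if $\|\cdot\|_*=\|\cdot\|_2$ and $c=2\max_{\|x\|\le1}\omega(x)$ otherwise.
   Context: Norms: $\mathbb{R}^n$ carries a norm $\|\cdot\|$ with dual norm $\|y\|_*=\sup_{\|x\|\le1}\langle x,y\rangle$; $\|\cdot\|_2$ is the Euclidean norm. $\mathbb{N}=\{1,2,\dots\}$ and $\mathbb{N}_0=\mathbb{N}\cup\{0\}$. Problem data: $\xi$ is a random vector with distribution $\mathcal{P}$ supported on $\Xi\subseteq\mathbb{R}^m$; $F(\cdot,\xi)$ is convex and differentiable for each $\xi\in\Xi$; $\Psi:\mathbb{R}^n\to\mathbb{R}\cup\{+\infty\}$ is a proper convex function, possibly nonsmooth, with effective domain $\mathrm{dom}\,\Psi=\{x:\Psi(x)<+\infty\}$. The function $f$ is convex and differentiable, with $\nabla f(x)=\mathbb{E}_\xi[\nabla_xF(x,\xi)]$. Bregman distance: $\omega:X\to\mathbb{R}$, with $\mathrm{dom}\,\Psi\subseteq X\subseteq\mathbb{R}^n$, is a distance generating function with modulus $1$ with respect to $\|\cdot\|$, i.e. $\omega$ is continuously differentiable and $\omega(y)\ge\omega(x)+\langle\nabla\omega(x),y-x\rangle+\frac12\|y-x\|^2$ for all $x,y\in X$. Its Bregman distance function is $D_\omega(x,y)=\omega(y)-\omega(x)-\langle\nabla\omega(x),y-x\rangle$. Algorithm: several processors share a memory holding the decision variable $x$ and update it without synchronization. Start from $x(0)\in\mathrm{dom}\,\Psi$, with batch size $b\in\mathbb{N}$ and positive step-sizes $\gamma(k)$.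 The counter $k$ is incremented each time $x$ is updated. For the update of $x(k)$, $d(k)$ denotes the time at which the point used to compute the averaged gradient was read from the shared memory, so $0\le d(k)\le k$; the delay $\tau(k):=k-d(k)$ satisfies $0\le\tau(k)\le\tau_{\max}$ for all $k\in\mathbb{N}_0$, where $\tau_{\max}$ is a nonnegative integer. At update $k$, with samples $\xi_1(k),\dots,\xi_b(k)$ drawn i.i.d. from $\mathcal{P}$ (each query of the sampling oracle generates a new i.i.d. sample), $$g_{\mathrm{ave}}(d(k))=\frac1b\sum_{i=1}^b\nabla_xF\bigl(x(d(k)),\xi_i(k)\bigr),\qquad x(k+1)=\operatorname*{argmin}_z\Bigl\{\langle g_{\mathrm{ave}}(d(k)),z\rangle+\Psi(z)+\frac1{\gamma(k)}D_\omega(x(k),z)\Bigr\}.$$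
   Formalization: That c lies in [1,b] is taken as a hypothesis on c, not a consequence of its formula: adding a constant to ω leaves D_ω unchanged but can make 2·max ω negative, and then the bound fails; the maximum is taken over points of the unit ball in X and assumed to be attained. *)

theory Defs
  imports "HOL-Probability.Probability"
begin

text \<open>An arbitrary norm on \<open>\<real>\<^sup>n\<close>, as opposed to the Euclidean norm \<^const>\<open>norm\<close> of the type.\<close>

definition is_norm :: "(real ^ 'n \<Rightarrow> real) \<Rightarrow> bool" where
  "is_norm N \<longleftrightarrow>
     (\<forall>x. N x = 0 \<longleftrightarrow> x = 0) \<and>
     (\<forall>x y. N (x + y) \<le> N x + N y) \<and>
     (\<forall>a x. N (a *\<^sub>R x) = \<bar>a\<bar> * N x)"

definition dual_norm :: "(real ^ 'n \<Rightarrow> real) \<Rightarrow> real ^ 'n \<Rightarrow> real" where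
  "dual_norm N y = (SUP x\<in>{x. N x \<le> 1}. x \<bullet> y)"

text \<open>Functions with values in \<open>\<real> \<union> {+\<infinity>}\<close> are modelled in \<^typ>\<open>ereal\<close>; properness excludes \<open>-\<infinity>\<close>.\<close>

definition eff_dom :: "(real ^ 'n \<Rightarrow> ereal) \<Rightarrow> (real ^ 'n) set" where
  "eff_dom \<Psi> = {x. \<Psi> x < \<infinity>}"

definition proper_fun :: "(real ^ 'n \<Rightarrow> ereal) \<Rightarrow> bool" where
  "proper_fun \<Psi> \<longleftrightarrow> (\<forall>x. \<Psi> x \<noteq> -\<infinity>) \<and> eff_dom \<Psi> \<noteq> {}"

text \<open>Multiplication in \<^typ>\<open>ereal\<close> satisfies \<open>0 * \<infinity> = 0\<close>, so the endpoints \<open>t = 0, 1\<close> are harmless.\<close>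

definition convex_fun :: "(real ^ 'n \<Rightarrow> ereal) \<Rightarrow> bool" where
  "convex_fun \<Psi> \<longleftrightarrow>
     (\<forall>x y. \<forall>t\<in>{0..1}.
        \<Psi> ((1 - t) *\<^sub>R x + t *\<^sub>R y) \<le> ereal (1 - t) * \<Psi> x + ereal t * \<Psi> y)"

definition lower_semicont :: "(real ^ 'n \<Rightarrow> ereal) \<Rightarrow> bool" where
  "lower_semicont \<Psi> \<longleftrightarrow> (\<forall>x. \<Psi> x \<le> Liminf (at x) \<Psi>)"

text \<open>
  Distance generating function with modulus 1 with respect to \<open>N\<close>. As \<open>X\<close> need not be open,
  derivatives are taken within \<open>X\<close>; \<open>g\<close> is the gradient map \<open>\<nabla>\<omega>\<close> on \<open>X\<close>.
\<close>

definition dist_gen_fun ::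
  "(real ^ 'n \<Rightarrow> real) \<Rightarrow> (real ^ 'n) set \<Rightarrow> (real ^ 'n \<Rightarrow> real) \<Rightarrow> (real ^ 'n \<Rightarrow> real ^ 'n) \<Rightarrow> bool" where
  "dist_gen_fun N X \<omega> g \<longleftrightarrow>
     (\<forall>x\<in>X. (\<omega> has_derivative (\<lambda>h. g x \<bullet> h)) (at x within X)) \<and>
     continuous_on X g \<and>
     (\<forall>x\<in>X. \<forall>y\<in>X. \<omega> y \<ge> \<omega> x + g x \<bullet> (y - x) + 1 / 2 * (N (y - x))\<^sup>2)"

definition bregman ::
  "(real ^ 'n \<Rightarrow> real) \<Rightarrow> (real ^ 'n \<Rightarrow> real ^ 'n) \<Rightarrow> real ^ 'n \<Rightarrow> real ^ 'n \<Rightarrow> real" where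
  "bregman \<omega> g x y = \<omega> y - \<omega> x - g x \<bullet> (y - x)"

definition minimizers :: "(real ^ 'n \<Rightarrow> ereal) \<Rightarrow> (real ^ 'n) set" where
  "minimizers \<phi> = {x. \<forall>y. \<phi> x \<le> \<phi> y}"

text \<open>
  Expectation of an extended-real random variable as the difference of the integrals of its
  positive and negative parts (\<^const>\<open>e2ennreal\<close> cuts off at 0). In \<^typ>\<open>ereal\<close>,
  \<open>\<infinity> - \<infinity> = \<infinity>\<close>, so a finite upper bound on the expectation is never vacuous.
\<close>

definition expect :: "'w measure \<Rightarrow> ('w \<Rightarrow> ereal) \<Rightarrow> ereal" where
  "expect M Y = enn2ereal (\<integral>\<^sup>+ w. e2ennreal (Y w) \<partial>M) - enn2ereal (\<integral>\<^sup>+ w. e2ennreal (- Y w) \<partial>M)"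

text \<open>The random variables \<open>\<xi> i k\<close> (sample \<open>i\<close> of update \<open>k\<close>) are i.i.d. with law \<open>P\<close>.\<close>

definition iid_samples ::
  "'w measure \<Rightarrow> (real ^ 'm) measure \<Rightarrow> nat \<Rightarrow> (nat \<Rightarrow> nat \<Rightarrow> 'w \<Rightarrow> real ^ 'm) \<Rightarrow> bool" where
  "iid_samples M P b \<xi> \<longleftrightarrow>
     prob_space.indep_vars M (\<lambda>_. borel) (\<lambda>(i, k). \<xi> i k) ({1..b} \<times> UNIV) \<and>
     (\<forall>i\<in>{1..b}. \<forall>k. distr M borel (\<xi> i k) = P)"

text \<open>Here \<open>DF z s\<close> is the gradient \<open>\<nabla>\<^sub>xF(z, s)\<close>.\<close>

definition ave_grad ::
  "(real ^ 'n \<Rightarrow> real ^ 'm \<Rightarrow> real ^ 'n) \<Rightarrow> nat \<Rightarrow> (nat \<Rightarrow> nat) \<Rightarrow> (nat \<Rightarrow> nat \<Rightarrow> 'w \<Rightarrow> real ^ 'm) \<Rightarrow>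
   (nat \<Rightarrow> 'w \<Rightarrow> real ^ 'n) \<Rightarrow> nat \<Rightarrow> 'w \<Rightarrow> real ^ 'n" where
  "ave_grad DF b d \<xi> x k w = (1 / real b) *\<^sub>R (\<Sum>i = 1..b. DF (x (d k) w) (\<xi> i k w))"

text \<open>
  \<open>x\<close> is a sequence of iterates with read times \<open>d\<close> and step-sizes \<open>\<gamma>\<close>. The objective of the
  subproblem is \<open>+\<infinity>\<close> off the effective domain of \<open>\<Psi>\<close>, so the values of \<open>\<omega>\<close> outside \<open>X\<close> play
  no role in the minimization. The iterates are random vectors, and the update rule is only
  imposed almost surely because the law of the samples is concentrated on \<open>\<Xi>\<close> only up to a null set.
\<close>

definition async_minibatch ::
  "'w measure \<Rightarrow> (real ^ 'n \<Rightarrow> real ^ 'm \<Rightarrow> real ^ 'n) \<Rightarrow> (real ^ 'n \<Rightarrow> ereal) \<Rightarrow>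
   (real ^ 'n \<Rightarrow> real) \<Rightarrow> (real ^ 'n \<Rightarrow> real ^ 'n) \<Rightarrow> nat \<Rightarrow> (nat \<Rightarrow> real) \<Rightarrow> (nat \<Rightarrow> nat) \<Rightarrow>
   (nat \<Rightarrow> nat \<Rightarrow> 'w \<Rightarrow> real ^ 'm) \<Rightarrow> real ^ 'n \<Rightarrow> (nat \<Rightarrow> 'w \<Rightarrow> real ^ 'n) \<Rightarrow> bool" where
  "async_minibatch M DF \<Psi> \<omega> g b \<gamma> d \<xi> x0 x \<longleftrightarrow>
     x0 \<in> eff_dom \<Psi> \<and>
     (\<forall>k. x k \<in> borel_measurable M) \<and>
     (\<forall>w\<in>space M. x 0 w = x0) \<and>
     (\<forall>k. AE w in M.
        is_arg_min
          (\<lambda>z. ereal (ave_grad DF b d \<xi> x k w \<bullet> z) + \<Psi> z + ereal (1 / \<gamma> k * bregman \<omega> g (x k w) z))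
          (\<lambda>_. True) (x (Suc k) w))"

definition cesaro_ave :: "(nat \<Rightarrow> 'w \<Rightarrow> real ^ 'n) \<Rightarrow> nat \<Rightarrow> 'w \<Rightarrow> real ^ 'n" where
  "cesaro_ave x T w = (1 / real T) *\<^sub>R (\<Sum>k = 1..T. x k w)"

text \<open>
  \<open>c = 1\<close> if the dual norm is the Euclidean one, and \<open>c = 2 max {\<omega> x | N x \<le> 1}\<close> otherwise. As \<open>\<omega>\<close>
  is a function on \<open>X\<close>, the maximum is over the points of the unit ball in \<open>X\<close>; it is expressed
  through a maximizer rather than \<^const>\<open>Sup\<close>, whose value is unspecified on unbounded sets.
\<close>

definition batch_const ::
  "(real ^ 'n \<Rightarrow> real) \<Rightarrow> (real ^ 'n) set \<Rightarrow> (real ^ 'n \<Rightarrow> real) \<Rightarrow> real \<Rightarrow> bool" where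
  "batch_const N X \<omega> c \<longleftrightarrow>
     (if dual_norm N = norm then c = 1
      else \<exists>u. is_arg_max \<omega> (\<lambda>x. x \<in> X \<and> N x \<le> 1) u \<and> c = 2 * \<omega> u)"

end

theory Submission
  imports Defs
begin

text \<open>
  The proof is a mirror-descent energy argument. Write \<open>\<mu> = \<gamma> L (\<tau>max + 1)\<^sup>2\<close>, which is less than 1, and
  \<open>D\<close> for the Bregman distance. The optimality condition of the update (\<open>prox_optimality\<close>) together
  with smoothness of \<open>f\<close> at the stale point \<open>x (d k)\<close> bounds \<open>\<phi> (x (k + 1)) - \<phi>\<^sup>\<star>\<close> by the telescoping
  difference \<open>(D (x k) x\<^sup>\<star> - D (x (k + 1)) x\<^sup>\<star>) / \<gamma>\<close>, minus \<open>D (x k) (x (k + 1)) / \<gamma>\<close>, plus two errors: the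
  staleness \<open>L / 2 \<parallel>x (k + 1) - x (d k)\<parallel>\<^sup>2\<close> and the noise \<open>\<langle>e, x (k + 1) - x\<^sup>\<star>\<rangle>\<close>, where \<open>e\<close> is the difference
  between the true and the averaged gradient at \<open>x (d k)\<close>.

  The negative Bregman term pays for both. A stale displacement consists of at most \<open>\<tau>max + 1\<close>
  consecutive steps and every step occurs in at most \<open>\<tau>max + 1\<close> of them, so after summation over
  \<open>k\<close> the staleness is paid for by the fraction \<open>\<mu>\<close> of that term. The remaining fraction
  \<open>1 - \<mu>\<close> pays for the noise.

  Given the past, the noise is a sum of \<open>b\<close> independent centred vectors \<open>e\<^sub>1, \<dots>, e\<^sub>b\<close>, one for every sample,
  but for a general norm the second moment of the dual norm of this sum may exceed \<open>\<sigma>\<^sup>2 / b\<close>. Therefore the samples are fed one by one to a chain of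
  auxiliary mirror steps that starts at \<open>z\<^sub>0 = x k\<close> (\<open>mirror_chain_bound\<close>). Sample \<open>i\<close> costs
  \<open>\<langle>e\<^sub>i, z\<^sub>i\<^sub>-\<^sub>1\<rangle>\<close> plus a multiple of \<open>\<parallel>e\<^sub>i\<parallel>\<^sub>*\<^sup>2\<close>. As \<open>z\<^sub>i\<^sub>-\<^sub>1\<close> is a function of earlier samples, the inner product
  \<open>\<langle>e\<^sub>i, z\<^sub>i\<^sub>-\<^sub>1 - x\<^sup>\<star>\<rangle>\<close> has mean zero, and the \<open>b\<close> squares add up to the noise term of the bound with 1 in
  place of \<open>c\<close>; the bound follows because \<open>1 \<le> c\<close>. In other words, smoothness of the convex conjugate
  of \<open>D (x k)\<close> is applied \<open>b\<close> times, once for every independent summand, which works for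
  every norm.

  It remains to justify the expectations. Mirror steps are Lipschitz in their dual variable, so the
  iterates and the chain are almost surely measurable functions of earlier samples
  (\<open>x_determined\<close>, \<open>chain_determined\<close>), hence independent of the current one. Square integrability of
  \<open>\<parallel>x k - x\<^sup>\<star>\<parallel>\<close> is obtained by induction on \<open>k\<close> from the energy inequality itself, which bounds
  \<open>D (x k) x\<^sup>\<star>\<close> by quantities that involve only earlier iterates (\<open>x_square_integrable\<close>).
\<close>

section \<open>Norms and dual norms\<close>

locale general_norm =
  fixes N :: "real ^ 'n \<Rightarrow> real"
  assumes is_norm: "is_norm N"
begin

abbreviation dual :: "real ^ 'n \<Rightarrow> real" where
  "dual \<equiv> dual_norm N"

lemma N_eq_0_iff [simp]: "N x = 0 \<longleftrightarrow> x = 0"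
  and N_triangle: "N (x + y) \<le> N x + N y"
  and N_scaleR: "N (a *\<^sub>R x) = \<bar>a\<bar> * N x"
  using is_norm by (auto simp: is_norm_def)

lemma N_0 [simp]: "N 0 = 0"
  using N_eq_0_iff by blast

lemma N_minus [simp]: "N (- x) = N x"
  using N_scaleR[of "-1" x] by simp

lemma N_minus_commute: "N (x - y) = N (y - x)"
  using N_minus[of "x - y"] by simp

lemma N_nonneg [simp]: "0 \<le> N x"
  using N_triangle[of x "- x"] by simp

lemma N_pos: "x \<noteq> 0 \<Longrightarrow> 0 < N x"
  using N_nonneg[of x] N_eq_0_iff[of x] by linarith

lemma N_sum_le: "N (\<Sum>i\<in>A. v i) \<le> (\<Sum>i\<in>A. N (v i))"
proof (induction A rule: infinite_finite_induct)
  case (insert a A)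
  then show ?case
    using N_triangle[of "v a" "\<Sum>i\<in>A. v i"] by simp
qed auto

lemma N_add_power2_le: "(N (x + y))\<^sup>2 \<le> 2 * (N x)\<^sup>2 + 2 * (N y)\<^sup>2"
proof -
  have "(N (x + y))\<^sup>2 \<le> (N x + N y)\<^sup>2"
    using N_triangle by (intro power_mono) auto
  also have "\<dots> \<le> 2 * (N x)\<^sup>2 + 2 * (N y)\<^sup>2"
    using sum_squares_bound[of "N x" "N y"] by (simp add: power2_sum)
  finally show ?thesis .
qed

text \<open>Continuity comes from convexity, as for every convex function on a finite-dimensional space.\<close>

lemma N_continuous: "continuous_on UNIV N"
proof (rule convex_on_continuous)
  show "convex_on UNIV N"
  proof (rule convex_onI)
    fix t :: real and x y
    assume "0 < t" "t < 1"
    then show "N ((1 - t) *\<^sub>R x + t *\<^sub>R y) \<le> (1 - t) * N x + t * N y"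
      using N_triangle[of "(1 - t) *\<^sub>R x" "t *\<^sub>R y"] by (simp add: N_scaleR)
  qed auto
qed auto

lemma N_measurable [measurable]: "N \<in> borel_measurable borel"
  by (rule borel_measurable_continuous_onI[OF N_continuous])

lemma N_dominates_norm:
  obtains m where "0 < m" "\<And>x. m * norm x \<le> N x"
proof -
  have "\<exists>u\<in>sphere 0 1. \<forall>v\<in>sphere 0 1. N u \<le> N v"
    by (intro continuous_attains_inf continuous_on_subset[OF N_continuous]) auto
  then obtain u :: "real ^ 'n" where u: "norm u = 1" "\<And>v. norm v = 1 \<Longrightarrow> N u \<le> N v"
    by auto
  have "N u * norm x \<le> N x" for x
  proof (cases "x = 0")
    case False
    have "N u \<le> N ((1 / norm x) *\<^sub>R x)"
      using False by (intro u) simp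
    also have "\<dots> = N x / norm x"
      by (simp add: N_scaleR)
    finally show ?thesis
      using False by (simp add: field_simps)
  qed simp
  moreover have "u \<noteq> 0"
    using u(1) by auto
  ultimately show ?thesis
    using that[of "N u"] N_pos by blast
qed

lemma unit_ball_inner_le:
  assumes m: "0 < m" "\<And>x. m * norm x \<le> N x" and x: "N x \<le> 1"
  shows "x \<bullet> y \<le> norm y / m"
proof -
  have "norm x \<le> 1 / m"
    using m(2)[of x] x m(1) by (simp add: field_simps)
  then have "norm x * norm y \<le> 1 / m * norm y"
    by (rule mult_right_mono) simp
  then show ?thesis
    using norm_cauchy_schwarz[of x y] by simp
qed

lemma dual_bdd_above: "bdd_above ((\<lambda>x. x \<bullet> y) ` {x. N x \<le> 1})"
proof -
  obtain m where m: "0 < m" "\<And>x. m * norm x \<le> N x"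
    by (rule N_dominates_norm) blast
  have "x \<bullet> y \<le> norm y / m" if "N x \<le> 1" for x
    using m that by (rule unit_ball_inner_le)
  then show ?thesis
    by (auto intro!: bdd_aboveI2)
qed

lemma inner_le_dual: "x \<bullet> y \<le> N x * dual y"
proof (cases "x = 0")
  case False
  then have pos: "0 < N x"
    by (rule N_pos)
  have "((1 / N x) *\<^sub>R x) \<bullet> y \<le> dual y"
    unfolding dual_norm_def using pos
    by (intro cSUP_upper dual_bdd_above) (simp add: N_scaleR)
  then show ?thesis
    using pos by (simp add: field_simps)
qed simp

lemma abs_inner_le_dual: "\<bar>x \<bullet> y\<bar> \<le> N x * dual y"
  using inner_le_dual[of x y] inner_le_dual[of "- x" y] by (simp add: abs_le_iff)

lemma dual_leI: "(\<And>x. N x \<le> 1 \<Longrightarrow> x \<bullet> y \<le> B) \<Longrightarrow> dual y \<le> B"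
  unfolding dual_norm_def by (intro cSUP_least) (auto intro: exI[of _ 0])

lemma dual_nonneg [simp]: "0 \<le> dual y"
  unfolding dual_norm_def by (rule cSUP_upper2[where x = 0, OF dual_bdd_above]) auto

lemma dual_0 [simp]: "dual 0 = 0"
  by (intro antisym dual_leI) auto

lemma dual_triangle: "dual (u + v) \<le> dual u + dual v"
proof (rule dual_leI)
  fix x
  assume x: "N x \<le> 1"
  have "x \<bullet> u \<le> 1 * dual u" "x \<bullet> v \<le> 1 * dual v"
    using inner_le_dual[of x u] inner_le_dual[of x v] mult_right_mono[OF x, of "dual u"]
      mult_right_mono[OF x, of "dual v"] by auto
  then show "x \<bullet> (u + v) \<le> dual u + dual v"
    by (simp add: inner_add_right)
qed

lemma dual_scaleR_le:
  assumes "0 \<le> a"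
  shows "dual (a *\<^sub>R v) \<le> a * dual v"
proof (rule dual_leI)
  fix x
  assume x: "N x \<le> 1"
  have "x \<bullet> v \<le> 1 * dual v"
    using inner_le_dual[of x v] mult_right_mono[OF x, of "dual v"] by auto
  then show "x \<bullet> (a *\<^sub>R v) \<le> a * dual v"
    using assms by (simp add: mult_left_mono)
qed

lemma dual_sum_le: "dual (\<Sum>i\<in>A. v i) \<le> (\<Sum>i\<in>A. dual (v i))"
proof (induction A rule: infinite_finite_induct)
  case (insert a A)
  then show ?case
    using dual_triangle[of "v a" "\<Sum>i\<in>A. v i"] by simp
qed auto

lemma dual_minus [simp]: "dual (- v) = dual v"
proof -
  have "dual (- v) \<le> dual v" for v
  proof (rule dual_leI)
    fix x
    assume x: "N x \<le> 1"
    have "(- x) \<bullet> v \<le> 1 * dual v"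
      using inner_le_dual[of "- x" v] mult_right_mono[OF x, of "dual v"] by auto
    then show "x \<bullet> (- v) \<le> dual v"
      by simp
  qed
  from this[of v] this[of "- v"] show ?thesis
    by simp
qed

lemma dual_continuous: "continuous_on UNIV dual"
proof (rule convex_on_continuous)
  show "convex_on UNIV dual"
  proof (rule convex_onI)
    fix t :: real and x y
    assume "0 < t" "t < 1"
    then show "dual ((1 - t) *\<^sub>R x + t *\<^sub>R y) \<le> (1 - t) * dual x + t * dual y"
      using dual_triangle[of "(1 - t) *\<^sub>R x" "t *\<^sub>R y"] dual_scaleR_le[of "1 - t" x]
        dual_scaleR_le[of t y] by simp
  qed auto
qed auto

lemma dual_measurable [measurable]: "dual \<in> borel_measurable borel"
  by (rule borel_measurable_continuous_onI[OF dual_continuous])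

text \<open>
  The Fenchel-Young inequality for \<open>a / 2 \<parallel>\<cdot>\<parallel>\<^sup>2\<close>, whose conjugate is \<open>\<parallel>\<cdot>\<parallel>\<^sub>*\<^sup>2 / (2 a)\<close>.
\<close>

lemma inner_minus_square_le:
  assumes "0 < a"
  shows "v \<bullet> x - a / 2 * (N x)\<^sup>2 \<le> (dual v)\<^sup>2 / (2 * a)"
proof -
  have "v \<bullet> x \<le> N x * dual v"
    using inner_le_dual[of x v] by (simp add: inner_commute)
  moreover have "0 \<le> (a * N x - dual v)\<^sup>2 / (2 * a)"
    using assms by simp
  moreover have "(a * N x - dual v)\<^sup>2 / (2 * a)
      = a / 2 * (N x)\<^sup>2 - N x * dual v + (dual v)\<^sup>2 / (2 * a)"
    using assms by (simp add: field_simps power2_eq_square)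
  ultimately show ?thesis
    by linarith
qed

text \<open>
  Along a fixed direction the values are Lipschitz with respect to \<open>N\<close>, by duality; continuity is then
  checked componentwise.
\<close>

lemma dual_lipschitz_continuous:
  assumes lip: "\<And>y z. dual (g y - g z) \<le> L * N (y - z)"
  shows "continuous_on UNIV g"
proof (subst continuous_on_componentwise, intro ballI)
  fix i :: "real ^ 'n"
  have "((\<lambda>q. g q \<bullet> i) \<longlongrightarrow> g p \<bullet> i) (at p)" for p
  proof -
    have "((\<lambda>q. N (q - p)) \<longlongrightarrow> N (p - p)) (at p)"
      using N_continuous
      by (intro isCont_tendsto_compose[where g = N] tendsto_intros)
        (auto simp: continuous_on_eq_continuous_at)
    then have lim: "((\<lambda>q. N i * (L * N (q - p))) \<longlongrightarrow> 0) (at p)"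
      by (intro tendsto_mult_right_zero) simp
    have "norm (g q \<bullet> i - g p \<bullet> i) \<le> N i * (L * N (q - p))" for q
    proof -
      have "norm (g q \<bullet> i - g p \<bullet> i) = \<bar>i \<bullet> (g q - g p)\<bar>"
        by (simp add: inner_diff_right inner_commute)
      also have "\<dots> \<le> N i * dual (g q - g p)"
        by (rule abs_inner_le_dual)
      also have "\<dots> \<le> N i * (L * N (q - p))"
        by (intro mult_left_mono lip) simp
      finally show ?thesis .
    qed
    then have "((\<lambda>q. g q \<bullet> i - g p \<bullet> i) \<longlongrightarrow> 0) (at p)"
      by (intro Lim_null_comparison[OF _ lim] always_eventually allI)
    then show ?thesis
      by (simp add: LIM_zero_iff)
  qed
  then show "continuous_on UNIV (\<lambda>q. g q \<bullet> i)"
    by (simp add: continuous_on_def)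
qed

end

section \<open>Smooth convex functions\<close>

text \<open>
  Only difference quotients along one segment enter, so it suffices that the segment lies in the
  set in which the derivative is taken.
\<close>

lemma directional_derivative_ge:
  fixes h :: "real ^ 'n \<Rightarrow> real"
  assumes der: "(h has_derivative D) (at p within S)"
    and seg: "\<And>t. 0 < t \<Longrightarrow> t \<le> 1 \<Longrightarrow> p + t *\<^sub>R v \<in> S"
    and ge: "\<And>t. 0 < t \<Longrightarrow> t \<le> 1 \<Longrightarrow> t * C \<le> h (p + t *\<^sub>R v) - h p"
  shows "C \<le> D v"
proof -
  have "((\<lambda>t. p + t *\<^sub>R v) has_derivative (\<lambda>t. t *\<^sub>R v)) (at 0 within {0<..1})"
    by (auto intro!: derivative_eq_intros)
  moreover have "(h has_derivative D) (at (p + 0 *\<^sub>R v) within (\<lambda>t. p + t *\<^sub>R v) ` {0<..1})"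
    using seg by (auto intro!: has_derivative_subset[OF der])
  ultimately have "((\<lambda>t. h (p + t *\<^sub>R v)) has_derivative (\<lambda>t. D (t *\<^sub>R v))) (at 0 within {0<..1})"
    using has_derivative_in_compose[of "\<lambda>t. p + t *\<^sub>R v" _ 0 "{0<..1}" h D] by simp
  moreover have "linear D"
    using der by (rule has_derivative_linear)
  ultimately have "((\<lambda>t. h (p + t *\<^sub>R v)) has_field_derivative D v) (at 0 within {0<..1})"
    by (simp add: has_field_derivative_def linear_cmul mult_commute_abs)
  then have lim: "((\<lambda>t. (h (p + t *\<^sub>R v) - h p) / t) \<longlongrightarrow> D v) (at 0 within {0<..1})"
    by (simp add: has_field_derivative_iff)
  have "at (0::real) within {0<..1} = at_right 0"
    by (rule at_within_nhd[of _ "{..<1}"]) auto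
  then have nontriv: "at (0::real) within {0<..1} \<noteq> bot"
    by simp
  have "C \<le> (h (p + t *\<^sub>R v) - h p) / t" if "t \<in> {0<..1}" for t
    using ge[of t] that by (simp add: field_simps)
  then have "eventually (\<lambda>t. C \<le> (h (p + t *\<^sub>R v) - h p) / t) (at 0 within {0<..1})"
    by (auto simp: eventually_at_filter)
  then show ?thesis
    by (rule tendsto_lowerbound[OF lim _ nontriv])
qed

text \<open>
  Convexity bounds difference quotients of \<open>f\<close> from above; for the lower bound on derivatives that
  \<open>directional_derivative_ge\<close> provides, \<open>f\<close> is negated.
\<close>

lemma convex_gradient_inequality:
  fixes f :: "real ^ 'n \<Rightarrow> real"
  assumes conv: "convex_on UNIV f" and grad: "GDERIV f x :> Df x"
  shows "f x + Df x \<bullet> (y - x) \<le> f y"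
proof -
  have "((\<lambda>z. - f z) has_derivative (\<lambda>h. - (h \<bullet> Df x))) (at x within UNIV)"
    using grad by (auto simp: gderiv_def intro!: derivative_intros)
  then have "- (f y - f x) \<le> - ((y - x) \<bullet> Df x)"
  proof (rule directional_derivative_ge)
    fix t :: real
    assume t: "0 < t" "t \<le> 1"
    have "f ((1 - t) *\<^sub>R x + t *\<^sub>R y) \<le> (1 - t) * f x + t * f y"
      using t by (intro convex_onD[OF conv]) auto
    moreover have "(1 - t) *\<^sub>R x + t *\<^sub>R y = x + t *\<^sub>R (y - x)"
      by (simp add: algebra_simps)
    ultimately show "t * - (f y - f x) \<le> - f (x + t *\<^sub>R (y - x)) - - f x"
      by (simp add: algebra_simps)
  qed auto
  then show ?thesis
    by (simp add: inner_commute)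
qed

lemma (in general_norm) descent_lemma:
  assumes grad: "\<And>y. GDERIV f y :> Df y"
    and lip: "\<And>y z. dual (Df y - Df z) \<le> L * N (y - z)"
  shows "f y \<le> f x + Df x \<bullet> (y - x) + L / 2 * (N (y - x))\<^sup>2"
proof -
  define v where "v = y - x"
  define h where "h t = f (x + t *\<^sub>R v) - t * (Df x \<bullet> v) - L / 2 * t\<^sup>2 * (N v)\<^sup>2" for t
  have "h 1 \<le> h 0"
  proof (rule DERIV_nonpos_imp_nonincreasing[where f = h and a = 0 and b = 1])
    fix t :: real
    assume t: "0 \<le> t" "t \<le> 1"
    let ?h' = "Df (x + t *\<^sub>R v) \<bullet> v - Df x \<bullet> v - L * t * (N v)\<^sup>2"
    have "((\<lambda>t. f (x + t *\<^sub>R v)) has_derivative (\<lambda>s. (s *\<^sub>R v) \<bullet> Df (x + t *\<^sub>R v))) (at t)"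
      by (rule has_derivative_compose[of "\<lambda>t. x + t *\<^sub>R v" "\<lambda>s. s *\<^sub>R v" t UNIV f])
        (use grad in \<open>auto simp: gderiv_def intro!: derivative_eq_intros\<close>)
    then have "((\<lambda>t. f (x + t *\<^sub>R v)) has_field_derivative Df (x + t *\<^sub>R v) \<bullet> v) (at t)"
      by (simp add: has_field_derivative_def inner_commute mult_commute_abs)
    then have der: "(h has_field_derivative ?h') (at t)"
      unfolding h_def by (auto intro!: derivative_eq_intros)
    have "(Df (x + t *\<^sub>R v) - Df x) \<bullet> v \<le> N v * dual (Df (x + t *\<^sub>R v) - Df x)"
      using inner_le_dual[of v "Df (x + t *\<^sub>R v) - Df x"] by (simp add: inner_commute)
    also have "\<dots> \<le> N v * (L * N (t *\<^sub>R v))"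
      using lip[of "x + t *\<^sub>R v" x] by (intro mult_left_mono) auto
    also have "\<dots> = L * t * (N v)\<^sup>2"
      using t by (simp add: N_scaleR power2_eq_square)
    finally show "\<exists>y. (h has_field_derivative y) (at t) \<and> y \<le> 0"
      using der by (intro exI[of _ ?h']) (simp add: inner_diff_left)
  qed simp
  then show ?thesis
    by (simp add: h_def v_def)
qed

section \<open>Mirror steps\<close>

text \<open>
  Derivatives of \<open>\<omega>\<close> are only available within \<open>X\<close>, so all optimization takes place over a closed convex
  subset \<open>C\<close>, which will be the effective domain of \<open>\<Psi>\<close>.
\<close>

locale mirror_map = general_norm N
  for N :: "real ^ 'n \<Rightarrow> real" +
  fixes X C :: "(real ^ 'n) set" and \<omega> :: "real ^ 'n \<Rightarrow> real" and D\<omega> :: "real ^ 'n \<Rightarrow> real ^ 'n"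
  assumes dgf: "dist_gen_fun N X \<omega> D\<omega>"
    and C_subset: "C \<subseteq> X" and C_convex: "convex C" and C_closed: "closed C"
begin

abbreviation D :: "real ^ 'n \<Rightarrow> real ^ 'n \<Rightarrow> real" where
  "D \<equiv> bregman \<omega> D\<omega>"

lemma D_ge: "x \<in> C \<Longrightarrow> y \<in> C \<Longrightarrow> (N (y - x))\<^sup>2 / 2 \<le> D x y"
  using dgf C_subset unfolding dist_gen_fun_def bregman_def by (simp add: subset_iff algebra_simps)

lemma D_nonneg: "x \<in> C \<Longrightarrow> y \<in> C \<Longrightarrow> 0 \<le> D x y"
  using D_ge[of x y] zero_le_power2[of "N (y - x)"] by linarith

lemma \<omega>_derivative: "x \<in> C \<Longrightarrow> (\<omega> has_derivative (\<lambda>h. D\<omega> x \<bullet> h)) (at x within C)"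
  using dgf C_subset by (auto simp: dist_gen_fun_def intro: has_derivative_subset)

lemma \<omega>_continuous: "continuous_on C \<omega>"
  using \<omega>_derivative by (auto simp: continuous_on_eq_continuous_within intro: has_derivative_continuous)

lemma D\<omega>_continuous: "continuous_on C D\<omega>"
  using dgf C_subset by (auto simp: dist_gen_fun_def intro: continuous_on_subset)

text \<open>
  A relation rather than a function: for a general \<open>\<psi>\<close> the minimum need not be attained for every \<open>\<theta>\<close>.
  Mirror steps of all kinds have this form, with \<open>\<theta> = \<nabla>\<omega>(x) - v\<close> for a step from \<open>x\<close> against \<open>v\<close>.
\<close>

definition prox :: "(real ^ 'n \<Rightarrow> real) \<Rightarrow> real ^ 'n \<Rightarrow> real ^ 'n \<Rightarrow> bool" where
  "prox \<psi> \<theta> z \<longleftrightarrow> z \<in> C \<and> (\<forall>y\<in>C. \<psi> z + \<omega> z - \<theta> \<bullet> z \<le> \<psi> y + \<omega> y - \<theta> \<bullet> y)"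

lemma prox_in: "prox \<psi> \<theta> z \<Longrightarrow> z \<in> C"
  by (simp add: prox_def)

text \<open>
  The minimized function exceeds its minimum by at least the Bregman distance from the minimizer. This
  contains the three-point inequality of mirror descent, and it is proved by comparing the minimizer
  with nearby points on the segment to \<open>y\<close>.
\<close>

lemma prox_optimality:
  assumes \<psi>: "convex_on C \<psi>" and z: "prox \<psi> \<theta> z" and y: "y \<in> C"
  shows "\<psi> z + \<omega> z - \<theta> \<bullet> z + D z y \<le> \<psi> y + \<omega> y - \<theta> \<bullet> y"
proof -
  have zC: "z \<in> C"
    using z by (rule prox_in)
  have seg: "z + t *\<^sub>R (y - z) \<in> C" if "0 < t" "t \<le> 1" for t
    using convexD[OF C_convex zC y, of "1 - t" t] that by (simp add: algebra_simps)
  have "\<theta> \<bullet> (y - z) - (\<psi> y - \<psi> z) \<le> D\<omega> z \<bullet> (y - z)"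
  proof (rule directional_derivative_ge[OF \<omega>_derivative[OF zC]])
    fix t :: real
    assume t: "0 < t" "t \<le> 1"
    have "\<psi> z + \<omega> z - \<theta> \<bullet> z
        \<le> \<psi> (z + t *\<^sub>R (y - z)) + \<omega> (z + t *\<^sub>R (y - z)) - \<theta> \<bullet> (z + t *\<^sub>R (y - z))"
      using z seg[OF t] by (simp add: prox_def)
    moreover have "\<psi> ((1 - t) *\<^sub>R z + t *\<^sub>R y) \<le> (1 - t) * \<psi> z + t * \<psi> y"
      using t zC y by (intro convex_onD[OF \<psi>]) auto
    moreover have "(1 - t) *\<^sub>R z + t *\<^sub>R y = z + t *\<^sub>R (y - z)"
      by (simp add: algebra_simps)
    ultimately show "t * (\<theta> \<bullet> (y - z) - (\<psi> y - \<psi> z)) \<le> \<omega> (z + t *\<^sub>R (y - z)) - \<omega> z"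
      by (simp add: algebra_simps inner_add_right inner_diff_right)
  qed (use seg in auto)
  then show ?thesis
    by (simp add: bregman_def inner_diff_right)
qed

text \<open>
  Adding the optimality inequalities of \<open>z\<close> and \<open>z'\<close> leaves \<open>\<parallel>z - z'\<parallel>\<^sup>2\<close> on one side and an inner
  product on the other.
\<close>

lemma prox_nonexpansive:
  assumes "convex_on C \<psi>" "prox \<psi> \<theta> z" "prox \<psi> \<theta>' z'"
  shows "N (z - z') \<le> dual (\<theta> - \<theta>')"
proof (cases "z = z'")
  case False
  have C: "z \<in> C" "z' \<in> C"
    using assms(2,3) by (auto dest: prox_in)
  have "D z z' + D z' z \<le> (z - z') \<bullet> (\<theta> - \<theta>')"
    using prox_optimality[OF assms(1,2) C(2)] prox_optimality[OF assms(1,3) C(1)]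
    by (simp add: inner_diff_left inner_diff_right inner_commute)
  also have "\<dots> \<le> N (z - z') * dual (\<theta> - \<theta>')"
    by (rule inner_le_dual)
  finally have "N (z - z') * N (z - z') \<le> N (z - z') * dual (\<theta> - \<theta>')"
    using D_ge[OF C] D_ge[OF C(2,1)] by (simp add: N_minus_commute power2_eq_square)
  then show ?thesis
    using N_pos[of "z - z'"] False by simp
qed simp

text \<open>
  Measurability of the iterates rests on this: a mirror step is a restriction of a continuous function
  of its dual variable. By nonexpansiveness it is Lipschitz on the set of \<open>\<theta>\<close> at which the minimum is
  attained, and it extends first to the closure of this set and then to the whole space.
\<close>

lemma prox_selection:
  assumes "convex_on C \<psi>"
  obtains Z where "continuous_on UNIV Z" "\<And>\<theta> z. prox \<psi> \<theta> z \<Longrightarrow> z = Z \<theta>"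
proof -
  obtain m where m: "0 < m" "\<And>x. m * norm x \<le> N x"
    by (rule N_dominates_norm) blast
  have dual_le: "dual v \<le> norm v / m" for v
    by (intro dual_leI unit_ball_inner_le[OF m])
  define S where "S = {\<theta>. \<exists>z. prox \<psi> \<theta> z}"
  define Z0 where "Z0 \<theta> = (SOME z. prox \<psi> \<theta> z)" for \<theta>
  have Z0: "prox \<psi> \<theta> (Z0 \<theta>)" if "\<theta> \<in> S" for \<theta>
    using that unfolding S_def Z0_def by (auto intro: someI_ex)
  have "(1 / m\<^sup>2)-lipschitz_on S Z0"
  proof (rule lipschitz_onI)
    fix \<theta> \<theta>'
    assume "\<theta> \<in> S" "\<theta>' \<in> S"
    then have "m * norm (Z0 \<theta> - Z0 \<theta>') \<le> norm (\<theta> - \<theta>') / m"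
      using prox_nonexpansive[OF assms Z0 Z0] m(2) dual_le by (meson order_trans)
    then show "dist (Z0 \<theta>) (Z0 \<theta>') \<le> 1 / m\<^sup>2 * dist \<theta> \<theta>'"
      using m(1) by (simp add: dist_norm field_simps power2_eq_square)
  qed simp
  then obtain Z1 where Z1: "(1 / m\<^sup>2)-lipschitz_on (closure S) Z1" "\<And>\<theta>. \<theta> \<in> S \<Longrightarrow> Z1 \<theta> = Z0 \<theta>"
    using lipschitz_extend_closure by metis
  obtain Z where Z: "continuous_on UNIV Z" "\<And>\<theta>. \<theta> \<in> closure S \<Longrightarrow> Z \<theta> = Z1 \<theta>"
    using Tietze_unbounded[OF lipschitz_on_continuous_on[OF Z1(1)], of UNIV] by auto
  have "z = Z \<theta>" if "prox \<psi> \<theta> z" for \<theta> z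
  proof -
    have S: "\<theta> \<in> S"
      using that by (auto simp: S_def)
    have "N (z - Z0 \<theta>) \<le> 0"
      using prox_nonexpansive[OF assms that Z0[OF S]] by simp
    with S show ?thesis
      using Z(2)[of \<theta>] Z1(2) closure_subset[of S] N_pos[of "z - Z0 \<theta>"]
      by (cases "z = Z0 \<theta>") auto
  qed
  then show ?thesis
    using Z(1) that by blast
qed

text \<open>
  Strong convexity makes \<open>\<omega> - \<langle>\<theta>, \<cdot>\<rangle>\<close> at least as large as at a fixed point \<open>p\<close> outside a compact subset
  of \<open>C\<close>, so a minimizer over this subset is a minimizer over \<open>C\<close>.
\<close>

lemma prox_zero_exists:
  assumes "C \<noteq> {}"
  shows "\<exists>z. prox (\<lambda>_. 0) \<theta> z"
proof -
  obtain p where p: "p \<in> C"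
    using assms by blast
  obtain m where m: "0 < m" "\<And>x. m * norm x \<le> N x"
    by (rule N_dominates_norm) blast
  define h where "h z = \<omega> z - \<theta> \<bullet> z" for z
  define K where "K = C \<inter> cball p (2 * dual (\<theta> - D\<omega> p) / m)"
  have far: "h p \<le> h y" if y: "y \<in> C" "y \<notin> K" for y
  proof -
    have "2 * dual (\<theta> - D\<omega> p) < m * norm (y - p)"
      using y m(1) by (simp add: K_def dist_norm norm_minus_commute field_simps)
    then have "2 * dual (\<theta> - D\<omega> p) \<le> N (y - p)"
      using m(2)[of "y - p"] by linarith
    then have "N (y - p) * (2 * dual (\<theta> - D\<omega> p)) \<le> N (y - p) * N (y - p)"
      by (rule mult_left_mono) simp
    then have "(y - p) \<bullet> (\<theta> - D\<omega> p) \<le> (N (y - p))\<^sup>2 / 2"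
      using inner_le_dual[of "y - p" "\<theta> - D\<omega> p"] by (simp add: power2_eq_square)
    then show ?thesis
      using D_ge[OF p y(1)]
      by (simp add: h_def bregman_def inner_diff_left inner_diff_right inner_commute)
  qed
  have "p \<in> K"
    using p m(1) by (simp add: K_def)
  moreover have "compact K"
    unfolding K_def using C_closed by (simp add: closed_Int_compact)
  moreover have "continuous_on K h"
    unfolding h_def K_def by (intro continuous_intros continuous_on_subset[OF \<omega>_continuous]) auto
  ultimately obtain z where z: "z \<in> K" "\<And>y. y \<in> K \<Longrightarrow> h z \<le> h y"
    using continuous_attains_inf[of K h] by blast
  have "h z \<le> h y" if "y \<in> C" for y
    using z(2)[of y] z(2)[OF \<open>p \<in> K\<close>] far[OF that] by (cases "y \<in> K") auto
  then show ?thesis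
    using z(1) by (auto simp: prox_def h_def K_def)
qed

definition mirror_point :: "real ^ 'n \<Rightarrow> real ^ 'n" where
  "mirror_point \<theta> = (SOME z. prox (\<lambda>_. 0) \<theta> z)"

lemma prox_mirror_point: "C \<noteq> {} \<Longrightarrow> prox (\<lambda>_. 0) \<theta> (mirror_point \<theta>)"
  unfolding mirror_point_def by (rule someI_ex[OF prox_zero_exists])

lemma convex_on_zero: "convex_on C (\<lambda>_. 0 :: real)"
  using C_convex by (simp add: convex_on_def)

lemma mirror_point_continuous:
  assumes "C \<noteq> {}"
  shows "continuous_on UNIV mirror_point"
proof -
  obtain Z where Z: "continuous_on UNIV Z" "\<And>\<theta> z. prox (\<lambda>_. 0) \<theta> z \<Longrightarrow> z = Z \<theta>"
    using prox_selection[OF convex_on_zero] by metis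
  have "mirror_point = Z"
    using Z(2) prox_mirror_point[OF assms] by blast
  with Z(1) show ?thesis
    by simp
qed

lemma prox_zero_self: "x \<in> C \<Longrightarrow> prox (\<lambda>_. 0) (D\<omega> x) x"
  using D_nonneg by (fastforce simp: prox_def bregman_def inner_diff_right)

text \<open>
  As \<open>\<nabla>\<omega>\<close> is only known to be continuous on \<open>C\<close>, it is replaced by 0 elsewhere to make it Borel.
\<close>

definition D\<omega>C :: "real ^ 'n \<Rightarrow> real ^ 'n" where
  "D\<omega>C p = indicat_real C p *\<^sub>R D\<omega> p"

lemma D\<omega>C_eq: "p \<in> C \<Longrightarrow> D\<omega>C p = D\<omega> p"
  by (simp add: D\<omega>C_def)

lemma D\<omega>C_measurable [measurable]: "D\<omega>C \<in> borel_measurable borel"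
  unfolding D\<omega>C_def using C_closed
  by (intro borel_measurable_continuous_on_indicator D\<omega>_continuous) auto

text \<open>
  The \<open>z i\<close> form a chain of dual-averaging steps from \<open>x\<close>. For each \<open>n\<close>, the left side is as a function
  of \<open>y\<close> what the point \<open>z n\<close> maximizes over \<open>C\<close>. Adding \<open>e (n + 1)\<close> to the functional increases its maximum
  by at most \<open>\<langle>e (n + 1), z n\<rangle> + \<parallel>e (n + 1)\<parallel>\<^sub>*\<^sup>2 / (2 a)\<close>, because the function falls off quadratically
  around \<open>z n\<close>. Each summand thus meets a point that depends on earlier summands only.
\<close>

lemma mirror_chain_bound:
  fixes n :: nat
  assumes a: "0 < a" and x: "x \<in> C" and y: "y \<in> C"
    and z: "\<And>i. i < n \<Longrightarrow> prox (\<lambda>_. 0) (D\<omega> x + (1 / a) *\<^sub>R (\<Sum>j=1..i. e j)) (z i)"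
  shows "(\<Sum>i=1..n. e i) \<bullet> y - a * D x y
           \<le> (\<Sum>i=1..n. e i \<bullet> z (i - 1) + (dual (e i))\<^sup>2 / (2 * a))"
  using y z
proof (induction n arbitrary: y)
  case 0
  then show ?case
    using a x D_nonneg by simp
next
  case (Suc n)
  let ?u = "\<Sum>j=1..n. e j"
  have zC: "z n \<in> C"
    using Suc.prems(2)[of n] by (auto dest: prox_in)
  have IH: "?u \<bullet> z n - a * D x (z n) \<le> (\<Sum>i=1..n. e i \<bullet> z (i - 1) + (dual (e i))\<^sup>2 / (2 * a))"
    using Suc.prems(2) zC by (intro Suc.IH) auto
  have "\<omega> (z n) - (D\<omega> x + (1 / a) *\<^sub>R ?u) \<bullet> z n + D (z n) y
      \<le> \<omega> y - (D\<omega> x + (1 / a) *\<^sub>R ?u) \<bullet> y"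
    using prox_optimality[OF _ Suc.prems(2)[of n] Suc.prems(1)] C_convex
    by (simp add: convex_on_def)
  then have "D x (z n) - (1 / a) * (?u \<bullet> z n) + D (z n) y \<le> D x y - (1 / a) * (?u \<bullet> y)"
    by (simp add: bregman_def inner_add_left inner_diff_right)
  then have "a * (D x (z n) - (1 / a) * (?u \<bullet> z n) + D (z n) y) \<le> a * (D x y - (1 / a) * (?u \<bullet> y))"
    using a by (intro mult_left_mono) auto
  then have "?u \<bullet> y - a * D x y \<le> ?u \<bullet> z n - a * D x (z n) - a * D (z n) y"
    using a by (simp add: algebra_simps)
  moreover have "a * ((N (y - z n))\<^sup>2 / 2) \<le> a * D (z n) y"
    using D_ge[OF zC Suc.prems(1)] a by (intro mult_left_mono) auto
  moreover have "e (Suc n) \<bullet> (y - z n) - a / 2 * (N (y - z n))\<^sup>2 \<le> (dual (e (Suc n)))\<^sup>2 / (2 * a)"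
    by (rule inner_minus_square_le[OF a])
  ultimately show ?case
    using IH by (simp add: inner_add_left inner_diff_right)
qed

end

section \<open>The descent inequality of the asynchronous method\<close>

text \<open>
  Exchange the sums: a given \<open>j\<close> lies in the window of \<open>k\<close> only for \<open>j \<le> k \<le> j + \<tau>\<close>.
\<close>

lemma delayed_window_sum_le:
  fixes s :: "nat \<Rightarrow> real"
  assumes "\<And>j. 0 \<le> s j"
  shows "(\<Sum>k<K. \<Sum>j=k-\<tau>..k. s j) \<le> (real \<tau> + 1) * (\<Sum>j<K. s j)"
proof -
  have "(\<Sum>k<K. \<Sum>j=k-\<tau>..k. s j) = (\<Sum>k<K. \<Sum>j | j \<in> {..<K} \<and> j \<in> {k-\<tau>..k}. s j)"
    by (intro sum.cong) auto
  also have "\<dots> = (\<Sum>j<K. \<Sum>k | k \<in> {..<K} \<and> j \<in> {k-\<tau>..k}. s j)"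
    by (rule sum.swap_restrict) auto
  also have "\<dots> \<le> (\<Sum>j<K. (real \<tau> + 1) * s j)"
  proof (rule sum_mono)
    fix j
    have "card {k. k \<in> {..<K} \<and> j \<in> {k-\<tau>..k}} \<le> card {j..j+\<tau>}"
      by (intro card_mono) auto
    then have "real (card {k. k \<in> {..<K} \<and> j \<in> {k-\<tau>..k}}) \<le> real \<tau> + 1"
      by simp
    then show "(\<Sum>k | k \<in> {..<K} \<and> j \<in> {k-\<tau>..k}. s j) \<le> (real \<tau> + 1) * s j"
      using assms by (simp add: mult_right_mono)
  qed
  finally show ?thesis
    by (simp add: sum_distrib_left)
qed

text \<open>
  The displacement is a sum of at most \<open>\<tau> + 1\<close> consecutive steps, to which Cauchy-Schwarz applies.
  The window may start before \<open>d\<close>, so that its position does not depend on the actual delay.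
\<close>

lemma (in general_norm) stale_distance_le:
  assumes "d \<le> k" "k - d \<le> \<tau>"
  shows "(N (p (Suc k) - p d))\<^sup>2 \<le> (real \<tau> + 1) * (\<Sum>j=k-\<tau>..k. (N (p (Suc j) - p j))\<^sup>2)"
proof -
  have "p (Suc k) - p d = (\<Sum>j=d..k. p (Suc j) - p j)"
    using assms(1) sum_Suc_diff[of d "Suc k" p] by (simp add: sum_Suc_diff)
  then have "N (p (Suc k) - p d) \<le> (\<Sum>j=d..k. N (p (Suc j) - p j))"
    using N_sum_le by metis
  then have "(N (p (Suc k) - p d))\<^sup>2 \<le> (\<Sum>j=d..k. N (p (Suc j) - p j))\<^sup>2"
    by (intro power_mono) auto
  also have "\<dots> \<le> real (card {d..k}) * (\<Sum>j=d..k. (N (p (Suc j) - p j))\<^sup>2)"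
    using Cauchy_Schwarz_ineq_sum[of "\<lambda>_. 1" "\<lambda>j. N (p (Suc j) - p j)" "{d..k}"] by simp
  also have "\<dots> \<le> (real \<tau> + 1) * (\<Sum>j=k-\<tau>..k. (N (p (Suc j) - p j))\<^sup>2)"
    using assms by (intro mult_mono sum_mono2 sum_nonneg) auto
  finally show ?thesis .
qed

context mirror_map
begin

text \<open>
  Smoothness compares \<open>f x'\<close> with the linearization of \<open>f\<close> at the stale point \<open>r\<close>, convexity compares that
  linearization with \<open>f y\<close>, and the optimality of the update handles \<open>\<psi>\<close>.
\<close>

lemma async_step:
  assumes \<gamma>: "0 < \<gamma>" and \<psi>: "convex_on C \<psi>"
    and f_convex: "convex_on UNIV f" and f_grad: "\<And>y. GDERIV f y :> Df y"
    and f_lip: "\<And>y z. dual (Df y - Df z) \<le> L * N (y - z)"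
    and x: "x \<in> C" and y: "y \<in> C"
    and step: "prox (\<lambda>z. \<gamma> * \<psi> z) (D\<omega> x - \<gamma> *\<^sub>R G) x'"
  shows "f x' + \<psi> x' - (f y + \<psi> y)
    \<le> (Df r - G) \<bullet> (x' - y) + L / 2 * (N (x' - r))\<^sup>2 + (D x y - D x x' - D x' y) / \<gamma>"
proof -
  have "f x' \<le> f r + Df r \<bullet> (x' - r) + L / 2 * (N (x' - r))\<^sup>2"
    by (rule descent_lemma[OF f_grad f_lip])
  moreover have "f r + Df r \<bullet> (y - r) \<le> f y"
    by (rule convex_gradient_inequality[OF f_convex f_grad])
  moreover have "\<gamma> * \<psi> x' + \<omega> x' - (D\<omega> x - \<gamma> *\<^sub>R G) \<bullet> x' + D x' y
      \<le> \<gamma> * \<psi> y + \<omega> y - (D\<omega> x - \<gamma> *\<^sub>R G) \<bullet> y"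
    using \<gamma> \<psi> by (intro prox_optimality[OF _ step y] convex_on_cmul) auto
  then have "\<gamma> * (\<psi> x' - \<psi> y + G \<bullet> (x' - y)) \<le> D x y - D x x' - D x' y"
    by (simp add: bregman_def inner_diff_left inner_diff_right algebra_simps)
  then have "\<psi> x' - \<psi> y + G \<bullet> (x' - y) \<le> (D x y - D x x' - D x' y) / \<gamma>"
    using \<gamma> by (simp add: field_simps)
  ultimately show ?thesis
    by (simp add: inner_diff_left inner_diff_right)
qed

text \<open>
  Of the Bregman term \<open>D (p k) (p (k + 1)) / \<gamma>\<close> gained in a step, the fraction \<open>\<mu>\<close> absorbs the staleness
  errors and the rest, with coefficient \<open>a = (1 - \<mu>) / \<gamma>\<close>, feeds the chain that processes the noise.
  The term \<open>D (p K) y / \<gamma>\<close> is kept on the left because it controls the moments of \<open>p K\<close>.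
\<close>

lemma async_descent:
  fixes b K :: nat
  assumes \<gamma>: "0 < \<gamma>" and L: "0 \<le> L" and \<psi>: "convex_on C \<psi>"
    and f_convex: "convex_on UNIV f" and f_grad: "\<And>y. GDERIV f y :> Df y"
    and f_lip: "\<And>y z. dual (Df y - Df z) \<le> L * N (y - z)"
    and small: "\<gamma> * L * (real \<tau> + 1)\<^sup>2 < 1"
    and a: "a = (1 - \<gamma> * L * (real \<tau> + 1)\<^sup>2) / \<gamma>"
    and delay: "\<And>k. d k \<le> k" "\<And>k. k - d k \<le> \<tau>"
    and p0: "p 0 \<in> C" and y: "y \<in> C"
    and step: "\<And>k. k < K \<Longrightarrow> prox (\<lambda>z. \<gamma> * \<psi> z) (D\<omega> (p k) - \<gamma> *\<^sub>R G k) (p (Suc k))"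
    and noise: "\<And>k. k < K \<Longrightarrow> Df (p (d k)) - G k = (\<Sum>i=1..b. e k i)"
    and z: "\<And>k i. k < K \<Longrightarrow> i < b \<Longrightarrow>
      prox (\<lambda>_. 0) (D\<omega> (p k) + (1 / a) *\<^sub>R (\<Sum>j=1..i. e k j)) (z k i)"
  shows "(\<Sum>k<K. f (p (Suc k)) + \<psi> (p (Suc k)) - (f y + \<psi> y)) + D (p K) y / \<gamma>
    \<le> D (p 0) y / \<gamma> + (\<Sum>k<K. \<Sum>i=1..b. e k i \<bullet> (z k (i - 1) - y) + (dual (e k i))\<^sup>2 / (2 * a))"
proof -
  define \<mu> where "\<mu> = \<gamma> * L * (real \<tau> + 1)\<^sup>2"
  have \<mu>: "0 \<le> \<mu>" "\<mu> < 1"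
    using \<gamma> L small by (auto simp: \<mu>_def)
  have a_pos: "0 < a" and a_\<mu>: "a = (1 - \<mu>) / \<gamma>"
    using \<gamma> \<mu> by (auto simp: a \<mu>_def)
  have pC: "p k \<in> C" if "k \<le> K" for k
    using that p0 by (cases k) (auto intro: prox_in[OF step])
  let ?R = "\<lambda>k. \<Sum>i=1..b. e k i \<bullet> (z k (i - 1) - y) + (dual (e k i))\<^sup>2 / (2 * a)"
  let ?s = "\<lambda>k. (N (p (Suc k) - p k))\<^sup>2"
  let ?c = "L * (real \<tau> + 1) / 2"
  have one: "f (p (Suc k)) + \<psi> (p (Suc k)) - (f y + \<psi> y)
      \<le> ?R k + ?c * (\<Sum>j=k-\<tau>..k. ?s j) - ?c * (real \<tau> + 1) * ?s k
        + (D (p k) y - D (p (Suc k)) y) / \<gamma>" if k: "k < K" for k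
  proof -
    let ?x = "p k" and ?x' = "p (Suc k)"
    have C: "?x \<in> C" "?x' \<in> C"
      using k by (auto intro: pC)
    have "f ?x' + \<psi> ?x' - (f y + \<psi> y)
      \<le> (Df (p (d k)) - G k) \<bullet> (?x' - y) + L / 2 * (N (?x' - p (d k)))\<^sup>2
        + (D ?x y - D ?x ?x' - D ?x' y) / \<gamma>"
      by (rule async_step[OF \<gamma> \<psi> f_convex f_grad f_lip C(1) y step[OF k]])
    moreover have "L / 2 * (N (?x' - p (d k)))\<^sup>2 \<le> L / 2 * ((real \<tau> + 1) * (\<Sum>j=k-\<tau>..k. ?s j))"
      using L by (intro mult_left_mono stale_distance_le delay) auto
    moreover have "(\<Sum>i=1..b. e k i) \<bullet> ?x' - a * D ?x ?x'
        \<le> (\<Sum>i=1..b. e k i \<bullet> z k (i - 1) + (dual (e k i))\<^sup>2 / (2 * a))"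
      by (rule mirror_chain_bound[OF a_pos C]) (rule z[OF k])
    moreover have "D ?x ?x' / \<gamma> = a * D ?x ?x' + \<mu> / \<gamma> * D ?x ?x'"
      using \<gamma> by (simp add: a_\<mu> field_simps)
    moreover have "\<mu> / \<gamma> * (?s k / 2) \<le> \<mu> / \<gamma> * D ?x ?x'"
      using \<mu> \<gamma> D_ge[OF C] by (intro mult_left_mono) auto
    \<comment> \<open>The fraction \<open>\<mu>\<close> is chosen so that this equals the total weight of step \<open>k\<close> in all the windows.\<close>
    moreover have "\<mu> / \<gamma> * (?s k / 2) = ?c * (real \<tau> + 1) * ?s k"
      using \<gamma> by (simp add: \<mu>_def power2_eq_square)
    moreover have "?R k = (\<Sum>i=1..b. e k i \<bullet> z k (i - 1) + (dual (e k i))\<^sup>2 / (2 * a))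
        - (\<Sum>i=1..b. e k i) \<bullet> y"
      by (simp add: inner_diff_right sum.distrib sum_subtractf inner_sum_left)
    ultimately show ?thesis
      unfolding noise[OF k] by (simp add: inner_diff_right diff_divide_distrib)
  qed
  have "(\<Sum>k<K. f (p (Suc k)) + \<psi> (p (Suc k)) - (f y + \<psi> y))
      \<le> (\<Sum>k<K. ?R k + ?c * (\<Sum>j=k-\<tau>..k. ?s j) - ?c * (real \<tau> + 1) * ?s k
        + (D (p k) y - D (p (Suc k)) y) / \<gamma>)"
    using one by (intro sum_mono) auto
  also have "\<dots> = (\<Sum>k<K. ?R k) + ?c * (\<Sum>k<K. \<Sum>j=k-\<tau>..k. ?s j) - ?c * (real \<tau> + 1) * (\<Sum>k<K. ?s k)
        + (D (p 0) y - D (p K) y) / \<gamma>"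
    using sum_lessThan_telescope'[of "\<lambda>k. D (p k) y" K]
    by (simp add: sum.distrib sum_subtractf sum_distrib_left flip: sum_divide_distrib)
  also have "\<dots> \<le> (\<Sum>k<K. ?R k) + (D (p 0) y - D (p K) y) / \<gamma>"
  proof -
    have "?c * (\<Sum>k<K. \<Sum>j=k-\<tau>..k. ?s j) \<le> ?c * ((real \<tau> + 1) * (\<Sum>k<K. ?s k))"
      using L by (intro mult_left_mono delayed_window_sum_le) auto
    then show ?thesis
      by simp
  qed
  finally show ?thesis
    by (simp add: diff_divide_distrib)
qed

end

section \<open>Measurability and independence\<close>

lemma lower_semicont_measurable:
  assumes "lower_semicont \<Psi>"
  shows "\<Psi> \<in> borel_measurable borel"
proof (rule borel_measurableI_greater)
  fix c :: ereal
  have "open {x. c < \<Psi> x}"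
  proof (subst open_subopen, intro ballI)
    fix x
    assume x: "x \<in> {x. c < \<Psi> x}"
    have "\<Psi> x \<le> Liminf (at x) \<Psi>"
      using assms by (simp add: lower_semicont_def)
    then have "eventually (\<lambda>y. c < \<Psi> y) (at x)"
      using x by (simp add: le_Liminf_iff)
    then obtain S where "open S" "x \<in> S" "\<forall>y\<in>S. y \<noteq> x \<longrightarrow> c < \<Psi> y"
      by (auto simp: eventually_at_topological)
    then show "\<exists>T. open T \<and> x \<in> T \<and> T \<subseteq> {x. c < \<Psi> x}"
      using x by (intro exI[of _ S]) auto
  qed
  then show "{x \<in> space borel. c < \<Psi> x} \<in> sets borel"
    by simp
qed

text \<open>
  Approximate the first argument by simple functions. With only finitely many values of it, joint
  measurability is clear, and continuity in this argument passes to the limit.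
\<close>

lemma caratheodory_measurable:
  fixes h :: "'a::euclidean_space \<Rightarrow> 's \<Rightarrow> 'b::euclidean_space"
  assumes cont: "\<And>s. s \<in> space P \<Longrightarrow> continuous_on UNIV (\<lambda>y. h y s)"
    and meas: "\<And>y. h y \<in> borel_measurable P"
  shows "(\<lambda>(y, s). h y s) \<in> borel_measurable (borel \<Otimes>\<^sub>M P)"
proof -
  let ?Q = "(borel :: 'a measure) \<Otimes>\<^sub>M P"
  obtain F where F: "\<And>i. simple_function ?Q (F i)"
      "\<And>w. w \<in> space ?Q \<Longrightarrow> (\<lambda>i. F i w) \<longlonglongrightarrow> fst w"
    using borel_measurable_implies_sequence_metric[of fst ?Q 0] by auto
  show ?thesis
  proof (rule borel_measurable_LIMSEQ_metric)
    fix i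
    have "F i \<in> ?Q \<rightarrow>\<^sub>M count_space (F i ` space ?Q)"
      by (rule measurable_simple_function[OF F(1), THEN measurable_count_space_extend[rotated 2]])
        auto
    show "(\<lambda>w. h (F i w) (snd w)) \<in> borel_measurable ?Q"
      by (rule measurable_compose_countable'[OF _ \<open>F i \<in> _\<close>])
        (auto intro!: measurable_compose[OF measurable_snd meas] countable_finite
          simple_functionD(1)[OF F(1)])
  next
    fix w
    assume w: "w \<in> space ?Q"
    then have "isCont (\<lambda>y. h y (snd w)) (fst w)"
      using cont by (auto simp: space_pair_measure continuous_on_eq_continuous_at)
    then have "(\<lambda>i. h (F i w) (snd w)) \<longlonglongrightarrow> h (fst w) (snd w)"
      by (rule isCont_tendsto_compose[OF _ F(2)[OF w]])
    then show "(\<lambda>i. h (F i w) (snd w)) \<longlonglongrightarrow> (case w of (y, s) \<Rightarrow> h y s)"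
      by (simp add: case_prod_beta)
  qed
qed

text \<open>
  The lower bound \<open>l\<close> makes both parts of the expectation finite, so that it is an ordinary integral.
\<close>

lemma expect_le_integral:
  assumes "prob_space M" and [measurable]: "Y \<in> borel_measurable M"
    and B: "integrable M B" and bounds: "AE w in M. ereal l \<le> Y w \<and> Y w \<le> ereal (B w)"
  shows "expect M Y \<le> ereal (integral\<^sup>L M B)"
proof -
  interpret prob_space M by fact
  define y where "y w = real_of_ereal (Y w)" for w
  have [measurable]: "y \<in> borel_measurable M"
    unfolding y_def by measurable
  have Y: "AE w in M. Y w = ereal (y w)"
    using bounds
  proof eventually_elim
    case (elim w)
    then show ?case
      by (cases "Y w") (auto simp: y_def)
  qed
  have y_bounds: "AE w in M. l \<le> y w \<and> y w \<le> B w"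
    using bounds Y by eventually_elim simp
  have y_int: "integrable M y"
  proof (rule Bochner_Integration.integrable_bound)
    show "integrable M (\<lambda>w. \<bar>l\<bar> + \<bar>B w\<bar>)"
      using B by auto
    show "AE w in M. norm (y w) \<le> norm (\<bar>l\<bar> + \<bar>B w\<bar>)"
      using y_bounds by eventually_elim auto
  qed simp
  have "(\<integral>\<^sup>+ w. e2ennreal (Y w) \<partial>M) = (\<integral>\<^sup>+ w. ennreal (y w) \<partial>M)"
    by (rule nn_integral_cong_AE) (use Y in eventually_elim, simp add: ennreal.abs_eq e2ennreal_ereal)
  moreover have "(\<integral>\<^sup>+ w. e2ennreal (- Y w) \<partial>M) = (\<integral>\<^sup>+ w. ennreal (- y w) \<partial>M)"
    by (rule nn_integral_cong_AE) (use Y in eventually_elim, simp)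
  moreover have "(\<integral>\<^sup>+ w. ennreal (y w) \<partial>M) < \<infinity>" "(\<integral>\<^sup>+ w. ennreal (- y w) \<partial>M) < \<infinity>"
    using y_int integrable_minus[OF y_int] by (auto simp: real_integrable_def top.not_eq_extremum)
  ultimately have "expect M Y = ereal (integral\<^sup>L M y)"
    unfolding expect_def real_lebesgue_integral_def[OF y_int]
    by (cases "\<integral>\<^sup>+ w. ennreal (y w) \<partial>M"; cases "\<integral>\<^sup>+ w. ennreal (- y w) \<partial>M") (auto simp: enn2ereal_ennreal)
  also have "\<dots> \<le> ereal (integral\<^sup>L M B)"
    using y_bounds by (auto intro!: integral_mono_AE y_int B elim: eventually_mono)
  finally show ?thesis .
qed

text \<open>
  A version of measurability with respect to the \<open>\<sigma>\<close>-algebra of the variables \<open>Z i\<close> with \<open>i\<close> in \<open>A\<close> that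
  ignores null sets. The updates are specified only almost surely, so exact measurability cannot be
  expected.
\<close>

definition determined_by ::
  "'w measure \<Rightarrow> ('i \<Rightarrow> 'w \<Rightarrow> 's::topological_space) \<Rightarrow> 'i set \<Rightarrow> ('w \<Rightarrow> 'b::topological_space) \<Rightarrow> bool" where
  "determined_by M Z A Y \<longleftrightarrow>
     (\<exists>h\<in>borel_measurable (PiM A (\<lambda>_. borel)). AE w in M. Y w = h (\<lambda>i\<in>A. Z i w))"

lemma determined_by_const: "determined_by M Z A (\<lambda>_. c)"
  unfolding determined_by_def by (rule bexI[of _ "\<lambda>_. c"]) auto

lemma determined_by_sample:
  assumes "i \<in> A"
  shows "determined_by M Z A (Z i)"
  unfolding determined_by_def
  using assms by (intro bexI[of _ "\<lambda>f. f i"]) (auto intro!: measurable_component_singleton)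

lemma determined_by_cong_AE:
  assumes "determined_by M Z A Y" "AE w in M. Y w = Y' w"
  shows "determined_by M Z A Y'"
proof -
  obtain h where h: "h \<in> borel_measurable (PiM A (\<lambda>_. borel))" "AE w in M. Y w = h (\<lambda>i\<in>A. Z i w)"
    using assms(1) by (auto simp: determined_by_def)
  have "AE w in M. Y' w = h (\<lambda>i\<in>A. Z i w)"
    using h(2) assms(2) by eventually_elim simp
  with h(1) show ?thesis
    by (auto simp: determined_by_def)
qed

lemma determined_by_mono:
  assumes "determined_by M Z A Y" "A \<subseteq> B"
  shows "determined_by M Z B Y"
proof -
  obtain h where h: "h \<in> borel_measurable (PiM A (\<lambda>_. borel))" "AE w in M. Y w = h (\<lambda>i\<in>A. Z i w)"
    using assms(1) by (auto simp: determined_by_def)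
  have "(\<lambda>f. h (restrict f A)) \<in> borel_measurable (PiM B (\<lambda>_. borel))"
    using assms(2) by (intro measurable_compose[OF measurable_restrict_subset h(1)])
  moreover have "AE w in M. Y w = h (restrict (\<lambda>i\<in>B. Z i w) A)"
    using h(2) assms(2) by (simp add: Int_absorb1)
  ultimately show ?thesis
    unfolding determined_by_def by (intro bexI[where x = "\<lambda>f. h (restrict f A)"])
qed

lemma determined_by_compose:
  assumes "determined_by M Z A Y" "G \<in> borel_measurable borel"
  shows "determined_by M Z A (\<lambda>w. G (Y w))"
proof -
  obtain h where h: "h \<in> borel_measurable (PiM A (\<lambda>_. borel))" "AE w in M. Y w = h (\<lambda>i\<in>A. Z i w)"
    using assms(1) by (auto simp: determined_by_def)
  have "(\<lambda>f. G (h f)) \<in> borel_measurable (PiM A (\<lambda>_. borel))"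
    by (rule measurable_compose[OF h(1) assms(2)])
  moreover have "AE w in M. G (Y w) = G (h (\<lambda>i\<in>A. Z i w))"
    using h(2) by eventually_elim simp
  ultimately show ?thesis
    unfolding determined_by_def by (intro bexI[where x = "\<lambda>f. G (h f)"])
qed

lemma determined_by_Pair:
  fixes Y :: "'w \<Rightarrow> 'b::second_countable_topology" and Y' :: "'w \<Rightarrow> 'c::second_countable_topology"
  assumes "determined_by M Z A Y" "determined_by M Z A Y'"
  shows "determined_by M Z A (\<lambda>w. (Y w, Y' w))"
proof -
  obtain h where h: "h \<in> borel_measurable (PiM A (\<lambda>_. borel))" "AE w in M. Y w = h (\<lambda>i\<in>A. Z i w)"
    using assms(1) by (auto simp: determined_by_def)
  obtain h' where h': "h' \<in> borel_measurable (PiM A (\<lambda>_. borel))"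
      "AE w in M. Y' w = h' (\<lambda>i\<in>A. Z i w)"
    using assms(2) by (auto simp: determined_by_def)
  have "(\<lambda>f. (h f, h' f)) \<in> borel_measurable (PiM A (\<lambda>_. borel))"
    using measurable_Pair[OF h(1) h'(1)] by (simp add: borel_prod)
  moreover have "AE w in M. (Y w, Y' w) = (h (\<lambda>i\<in>A. Z i w), h' (\<lambda>i\<in>A. Z i w))"
    using h(2) h'(2) by eventually_elim simp
  ultimately show ?thesis
    unfolding determined_by_def by (intro bexI[where x = "\<lambda>f. (h f, h' f)"])
qed

lemma determined_by_compose2:
  fixes Y :: "'w \<Rightarrow> 'b::second_countable_topology" and Y' :: "'w \<Rightarrow> 'c::second_countable_topology"
  assumes "determined_by M Z A Y" "determined_by M Z A Y'"
    and "(\<lambda>(u, v). G u v) \<in> borel_measurable (borel \<Otimes>\<^sub>M borel)"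
  shows "determined_by M Z A (\<lambda>w. G (Y w) (Y' w))"
  using determined_by_compose[OF determined_by_Pair[OF assms(1,2)], of "\<lambda>(u, v). G u v"] assms(3)
  by (simp add: borel_prod)

lemma determined_by_sum:
  fixes Y :: "'j \<Rightarrow> 'w \<Rightarrow> 'b::euclidean_space"
  assumes "\<And>j. j \<in> J \<Longrightarrow> determined_by M Z A (Y j)"
  shows "determined_by M Z A (\<lambda>w. \<Sum>j\<in>J. Y j w)"
  using assms
proof (induction J rule: infinite_finite_induct)
  case (insert j J)
  then have "determined_by M Z A (\<lambda>w. Y j w + (\<Sum>j\<in>J. Y j w))"
    by (intro determined_by_compose2[where G = "(+)"]) auto
  with insert show ?case
    by simp
qed (auto intro: determined_by_const)

context prob_space
begin

text \<open>
  The joint law of a variable determined by the past and a fresh sample is the product of their laws.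
  Independence of two blocks of samples gives this for the function \<open>h\<close> of the past, and laws do not
  see the null set on which \<open>Y\<close> differs from it.
\<close>

lemma fresh_sample_distr:
  fixes Z :: "'i \<Rightarrow> 'a \<Rightarrow> 's::topological_space" and Y :: "'a \<Rightarrow> 'b::topological_space"
  assumes ind: "indep_vars (\<lambda>_. borel) Z I" and i: "i \<in> I" "i \<notin> A" and A: "A \<subseteq> I"
    and Y: "determined_by M Z A Y" and Ym: "Y \<in> borel_measurable M"
  shows "distr M (borel \<Otimes>\<^sub>M borel) (\<lambda>w. (Y w, Z i w)) = distr M borel Y \<Otimes>\<^sub>M distr M borel (Z i)"
proof -
  obtain h where h: "h \<in> borel_measurable (PiM A (\<lambda>_. borel))" "AE w in M. Y w = h (\<lambda>i\<in>A. Z i w)"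
    using Y by (auto simp: determined_by_def)
  let ?Y = "\<lambda>w. h (\<lambda>i\<in>A. Z i w)"
  let ?PA = "PiM A (\<lambda>_. borel)" and ?Pi = "PiM {i} (\<lambda>_. borel)"
  let ?RA = "\<lambda>w. \<lambda>i\<in>A. Z i w" and ?Ri = "\<lambda>w. \<lambda>i\<in>{i}. Z i w"
  have "indep_var ?PA ?RA ?Pi ?Ri"
    using i A by (intro indep_var_restrict[OF ind]) auto
  then have R: "?RA \<in> M \<rightarrow>\<^sub>M ?PA" "?Ri \<in> M \<rightarrow>\<^sub>M ?Pi"
    and R_prod: "distr M ?PA ?RA \<Otimes>\<^sub>M distr M ?Pi ?Ri = distr M (?PA \<Otimes>\<^sub>M ?Pi) (\<lambda>w. (?RA w, ?Ri w))"
    by (auto simp: indep_var_distribution_eq)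
  have at_i: "(\<lambda>f. f i) \<in> ?Pi \<rightarrow>\<^sub>M borel"
    by (rule measurable_component_singleton) simp
  have meas: "?Y \<in> borel_measurable M" "Z i \<in> borel_measurable M"
    using measurable_compose[OF R(1) h(1)] measurable_compose[OF R(2) at_i] by auto
  interpret Zi: prob_space "distr M borel (Z i)"
    using meas(2) by (rule prob_space_distr)
  have "distr M borel ?Y = distr (distr M ?PA ?RA) borel h"
    and Zi: "distr M borel (Z i) = distr (distr M ?Pi ?Ri) borel (\<lambda>f. f i)"
    using R h(1) at_i by (auto simp: distr_distr comp_def)
  then have "distr M borel ?Y \<Otimes>\<^sub>M distr M borel (Z i)
      = distr (distr M ?PA ?RA) borel h \<Otimes>\<^sub>M distr (distr M ?Pi ?Ri) borel (\<lambda>f. f i)"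
    by simp
  also have "\<dots> = distr (distr M ?PA ?RA \<Otimes>\<^sub>M distr M ?Pi ?Ri) (borel \<Otimes>\<^sub>M borel) (\<lambda>(f, g). (h f, g i))"
    using h(1) at_i Zi.sigma_finite_measure_axioms unfolding Zi
    by (intro pair_measure_distr) auto
  also have "\<dots> = distr M (borel \<Otimes>\<^sub>M borel) (\<lambda>w. (?Y w, Z i w))"
    unfolding R_prod
    using measurable_Pair[OF measurable_compose[OF measurable_fst h(1)]
        measurable_compose[OF measurable_snd at_i]] measurable_Pair[OF R]
    by (subst distr_distr) (simp_all add: comp_def case_prod_beta')
  finally have prod: "distr M borel ?Y \<Otimes>\<^sub>M distr M borel (Z i)
      = distr M (borel \<Otimes>\<^sub>M borel) (\<lambda>w. (?Y w, Z i w))" .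
  have "distr M borel ?Y = distr M borel Y"
    using h(2) by (intro distr_cong_AE meas Ym) (auto elim: eventually_mono)
  moreover have "distr M (borel \<Otimes>\<^sub>M borel) (\<lambda>w. (?Y w, Z i w))
      = distr M (borel \<Otimes>\<^sub>M borel) (\<lambda>w. (Y w, Z i w))"
    using h(2) by (intro distr_cong_AE measurable_Pair meas Ym) (auto elim: eventually_mono)
  ultimately show ?thesis
    using prod by simp
qed

lemma fresh_sample_nn_integral:
  fixes Z :: "'i \<Rightarrow> 'a \<Rightarrow> 's::topological_space" and Y :: "'a \<Rightarrow> 'b::topological_space"
  assumes ind: "indep_vars (\<lambda>_. borel) Z I" and i: "i \<in> I" "i \<notin> A" and A: "A \<subseteq> I"
    and Y: "determined_by M Z A Y" and Ym: "Y \<in> borel_measurable M"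
    and G: "(\<lambda>(y, s). G y s) \<in> borel_measurable (borel \<Otimes>\<^sub>M borel)"
    and le: "\<And>y. (\<integral>\<^sup>+ s. G y s \<partial>distr M borel (Z i)) \<le> c"
  shows "(\<integral>\<^sup>+ w. G (Y w) (Z i w) \<partial>M) \<le> c"
proof -
  have Zm: "Z i \<in> borel_measurable M"
    using ind i(1) by (auto simp: indep_vars_def)
  interpret Y: prob_space "distr M borel Y"
    using Ym by (rule prob_space_distr)
  interpret Z: prob_space "distr M borel (Z i)"
    using Zm by (rule prob_space_distr)
  have G': "(\<lambda>(y, s). G y s) \<in> borel_measurable (distr M borel Y \<Otimes>\<^sub>M distr M borel (Z i))"
    using G by (simp cong: measurable_cong_sets sets_pair_measure_cong)
  have "(\<integral>\<^sup>+ w. G (Y w) (Z i w) \<partial>M)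
      = (\<integral>\<^sup>+ v. (\<lambda>(y, s). G y s) v \<partial>distr M (borel \<Otimes>\<^sub>M borel) (\<lambda>w. (Y w, Z i w)))"
    by (subst nn_integral_distr) (auto intro!: measurable_Pair Ym Zm G)
  also have "\<dots> = (\<integral>\<^sup>+ y. \<integral>\<^sup>+ s. G y s \<partial>distr M borel (Z i) \<partial>distr M borel Y)"
    unfolding fresh_sample_distr[OF ind i A Y Ym] using Z.nn_integral_fst[OF G'] by simp
  also have "\<dots> \<le> (\<integral>\<^sup>+ y. c \<partial>distr M borel Y)"
    by (intro nn_integral_mono le)
  also have "\<dots> = c"
    using Y.emeasure_space_1 by simp
  finally show ?thesis .
qed

lemma fresh_sample_integral_zero:
  fixes Z :: "'i \<Rightarrow> 'a \<Rightarrow> 's::topological_space" and Y :: "'a \<Rightarrow> 'b::topological_space"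
    and G :: "'b \<Rightarrow> 's \<Rightarrow> real"
  assumes ind: "indep_vars (\<lambda>_. borel) Z I" and i: "i \<in> I" "i \<notin> A" and A: "A \<subseteq> I"
    and Y: "determined_by M Z A Y" and Ym: "Y \<in> borel_measurable M"
    and G: "(\<lambda>(y, s). G y s) \<in> borel_measurable (borel \<Otimes>\<^sub>M borel)"
    and int: "integrable M (\<lambda>w. G (Y w) (Z i w))"
    and zero: "\<And>y. (\<integral>s. G y s \<partial>distr M borel (Z i)) = 0"
  shows "(\<integral>w. G (Y w) (Z i w) \<partial>M) = 0"
proof -
  have Zm: "Z i \<in> borel_measurable M"
    using ind i(1) by (auto simp: indep_vars_def)
  have YZ: "(\<lambda>w. (Y w, Z i w)) \<in> M \<rightarrow>\<^sub>M borel \<Otimes>\<^sub>M borel"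
    by (intro measurable_Pair Ym Zm)
  interpret Y: prob_space "distr M borel Y"
    using Ym by (rule prob_space_distr)
  interpret Z: prob_space "distr M borel (Z i)"
    using Zm by (rule prob_space_distr)
  interpret YZ: pair_sigma_finite "distr M borel Y" "distr M borel (Z i)" ..
  have "(\<integral>w. G (Y w) (Z i w) \<partial>M)
      = (\<integral>v. (\<lambda>(y, s). G y s) v \<partial>distr M (borel \<Otimes>\<^sub>M borel) (\<lambda>w. (Y w, Z i w)))"
    by (subst integral_distr[OF YZ G]) simp
  also have "\<dots> = (\<integral>y. \<integral>s. G y s \<partial>distr M borel (Z i) \<partial>distr M borel Y)"
  proof -
    have "integrable (distr M (borel \<Otimes>\<^sub>M borel) (\<lambda>w. (Y w, Z i w))) (\<lambda>(y, s). G y s)"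
      using int by (subst integrable_distr_eq[OF YZ G]) simp
    then show ?thesis
      unfolding fresh_sample_distr[OF ind i A Y Ym] by (rule YZ.integral_fst[symmetric])
  qed
  finally show ?thesis
    by (simp add: zero)
qed

end

section \<open>The stochastic method\<close>

text \<open>
  The method in real-valued form. The function \<open>\<psi>\<close> is \<open>\<Psi>\<close> on its effective domain \<open>C\<close>, and \<open>err p s\<close> is a
  jointly measurable version of the gradient error \<open>\<nabla>f(p) - \<nabla>F(p, s)\<close>; sample \<open>i\<close> of update \<open>k\<close> has index
  \<open>(i, k)\<close>.
\<close>

locale async_mirror_descent = mirror_map N X C \<omega> D\<omega> + prob_space M
  for N :: "real ^ 'n \<Rightarrow> real" and X C :: "(real ^ 'n) set"
    and \<omega> :: "real ^ 'n \<Rightarrow> real" and D\<omega> :: "real ^ 'n \<Rightarrow> real ^ 'n" and M :: "'w measure" +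
  fixes f \<psi> :: "real ^ 'n \<Rightarrow> real" and Df :: "real ^ 'n \<Rightarrow> real ^ 'n"
    and err :: "real ^ 'n \<Rightarrow> real ^ 'm \<Rightarrow> real ^ 'n"
    and Z :: "nat \<times> nat \<Rightarrow> 'w \<Rightarrow> real ^ 'm"
    and L \<sigma> \<gamma> :: real and b \<tau> :: nat and d :: "nat \<Rightarrow> nat"
    and x :: "nat \<Rightarrow> 'w \<Rightarrow> real ^ 'n" and x0 y :: "real ^ 'n"
  assumes \<psi>_convex: "convex_on C \<psi>"
    and f_convex: "convex_on UNIV f" and f_grad: "\<And>y. GDERIV f y :> Df y"
    and Df_lipschitz: "\<And>y z. dual (Df y - Df z) \<le> L * N (y - z)"
    and L: "0 \<le> L" and \<gamma>: "0 < \<gamma>" "\<gamma> * L * (real \<tau> + 1)\<^sup>2 < 1" and b: "1 \<le> b"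
    and delay: "\<And>k. d k \<le> k" "\<And>k. k - d k \<le> \<tau>"
    and x_measurable [measurable]: "\<And>k. x k \<in> borel_measurable M"
    and x0: "x0 \<in> C" "\<And>w. w \<in> space M \<Longrightarrow> x 0 w = x0"
    and y: "y \<in> C" "\<And>z. z \<in> C \<Longrightarrow> f y + \<psi> y \<le> f z + \<psi> z"
    and samples: "indep_vars (\<lambda>_. borel) Z ({1..b} \<times> UNIV)"
    and err_measurable: "(\<lambda>(p, s). err p s) \<in> borel_measurable (borel \<Otimes>\<^sub>M borel)"
    and err_mean: "\<And>i k p v. i \<in> {1..b} \<Longrightarrow> (\<integral>s. err p s \<bullet> v \<partial>distr M borel (Z (i, k))) = 0"
    and err_variance: "\<And>i k p. i \<in> {1..b} \<Longrightarrow>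
      (\<integral>\<^sup>+ s. ennreal ((dual (err p s))\<^sup>2) \<partial>distr M borel (Z (i, k))) \<le> ennreal (\<sigma>\<^sup>2)"
    and step: "\<And>k. AE w in M. prox (\<lambda>z. \<gamma> * \<psi> z)
      (D\<omega> (x k w) - \<gamma> *\<^sub>R (Df (x (d k) w) - (1 / real b) *\<^sub>R (\<Sum>i=1..b. err (x (d k) w) (Z (i, k) w))))
      (x (Suc k) w)"
begin

text \<open>
  The coefficient of the Bregman term that is left for the noise once the staleness has been paid for.
\<close>

definition slack :: real where
  "slack = (1 - \<gamma> * L * (real \<tau> + 1)\<^sup>2) / \<gamma>"

definition noise :: "nat \<Rightarrow> nat \<Rightarrow> 'w \<Rightarrow> real ^ 'n" where
  "noise k i w = (1 / real b) *\<^sub>R err (x (d k) w) (Z (i, k) w)"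

definition chain :: "nat \<Rightarrow> nat \<Rightarrow> 'w \<Rightarrow> real ^ 'n" where
  "chain k i w = mirror_point (D\<omega>C (x k w) + (1 / slack) *\<^sub>R (\<Sum>j=1..i. noise k j w))"

text \<open>
  What update \<open>k\<close> adds to the energy bound: martingale differences plus squared noise norms.
\<close>

definition excess :: "nat \<Rightarrow> 'w \<Rightarrow> real" where
  "excess k w = (\<Sum>i=1..b. noise k i w \<bullet> (chain k (i - 1) w - y) + (dual (noise k i w))\<^sup>2 / (2 * slack))"

text \<open>
  The samples drawn before sample \<open>i\<close> of update \<open>k\<close>. As samples are numbered from 1, \<open>history k 1\<close>
  consists of those of the updates before \<open>k\<close>.
\<close>

definition history :: "nat \<Rightarrow> nat \<Rightarrow> (nat \<times> nat) set" where
  "history k i = {(j, l). j \<in> {1..b} \<and> (l < k \<or> l = k \<and> j < i)}"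

lemma slack_pos: "0 < slack"
  using \<gamma> by (simp add: slack_def)

lemma C_nonempty: "C \<noteq> {}"
  using y by auto

lemma Df_measurable [measurable]: "Df \<in> borel_measurable borel"
  by (rule borel_measurable_continuous_onI[OF dual_lipschitz_continuous[OF Df_lipschitz]])

lemma Z_measurable [measurable]: "i \<in> {1..b} \<Longrightarrow> Z (i, k) \<in> borel_measurable M"
  using samples by (auto simp: indep_vars_def)

lemma noise_measurable [measurable]:
  assumes "i \<in> {1..b}"
  shows "noise k i \<in> borel_measurable M"
proof -
  have "(\<lambda>w. (x (d k) w, Z (i, k) w)) \<in> M \<rightarrow>\<^sub>M borel \<Otimes>\<^sub>M borel"
    by (intro measurable_Pair x_measurable Z_measurable assms)
  from measurable_compose[OF this err_measurable] show ?thesis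
    unfolding noise_def[abs_def] by simp
qed

lemma mirror_point_measurable [measurable]: "mirror_point \<in> borel_measurable borel"
  by (intro borel_measurable_continuous_onI mirror_point_continuous C_nonempty)

lemma chain_measurable [measurable]:
  assumes "i \<le> b"
  shows "chain k i \<in> borel_measurable M"
  unfolding chain_def[abs_def] using assms
  by (intro measurable_compose[OF _ mirror_point_measurable] borel_measurable_add
      borel_measurable_scaleR borel_measurable_sum measurable_compose[OF _ D\<omega>C_measurable]) auto

lemma x_in_C: "AE w in M. x k w \<in> C"
proof (cases k)
  case 0
  then show ?thesis
    using x0 by (auto intro!: AE_I2)
next
  case (Suc l)
  then show ?thesis
    using step[of l] by (auto elim!: eventually_mono intro: prox_in)
qed

text \<open>
  An update that minimizes is the value of a continuous function at its dual variable, which is built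
  from past iterates and from samples of the current update.
\<close>

lemma x_determined: "determined_by M Z (history k 1) (x k)"
proof (induction k rule: less_induct)
  case (less k)
  show ?case
  proof (cases k)
    case 0
    have "determined_by M Z (history k 1) (\<lambda>_. x0)"
      by (rule determined_by_const)
    then show ?thesis
      by (rule determined_by_cong_AE) (use x0(2) 0 in \<open>auto intro!: AE_I2\<close>)
  next
    case (Suc l)
    have "convex_on C (\<lambda>z. \<gamma> * \<psi> z)"
      using \<gamma> by (intro convex_on_cmul \<psi>_convex) auto
    then obtain S where S: "continuous_on UNIV S" "\<And>\<theta> z. prox (\<lambda>z. \<gamma> * \<psi> z) \<theta> z \<Longrightarrow> z = S \<theta>"
      using prox_selection by metis
    have past: "determined_by M Z (history k 1) (x j)" if "j \<le> l" for j
    proof (rule determined_by_mono)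
      show "determined_by M Z (history j 1) (x j)"
        using that Suc by (intro less) auto
      show "history j 1 \<subseteq> history k 1"
        using that Suc by (auto simp: history_def)
    qed
    let ?E = "\<lambda>w. \<Sum>i=1..b. err (x (d l) w) (Z (i, l) w)"
    have E: "determined_by M Z (history k 1) ?E"
    proof (intro determined_by_sum determined_by_compose2[where G = err] past delay err_measurable)
      show "determined_by M Z (history k 1) (Z (i, l))" if "i \<in> {1..b}" for i
        using that Suc by (intro determined_by_sample) (auto simp: history_def)
    qed
    have "determined_by M Z (history k 1)
        (\<lambda>w. D\<omega>C (x l w) - \<gamma> *\<^sub>R (Df (x (d l) w) - (1 / real b) *\<^sub>R ?E w))"
      by (intro determined_by_compose2[where G = "\<lambda>u v. u - \<gamma> *\<^sub>R v"]
          determined_by_compose2[where G = "\<lambda>u v. u - (1 / real b) *\<^sub>R v"]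
          determined_by_compose[where G = D\<omega>C] determined_by_compose[where G = Df] E past delay) auto
    then have "determined_by M Z (history k 1)
        (\<lambda>w. S (D\<omega>C (x l w) - \<gamma> *\<^sub>R (Df (x (d l) w) - (1 / real b) *\<^sub>R ?E w)))"
      by (rule determined_by_compose) (rule borel_measurable_continuous_onI[OF S(1)])
    then show ?thesis
    proof (rule determined_by_cong_AE)
      show "AE w in M. S (D\<omega>C (x l w) - \<gamma> *\<^sub>R (Df (x (d l) w) - (1 / real b) *\<^sub>R ?E w)) = x k w"
        using step[of l] x_in_C[of l]
      proof eventually_elim
        case (elim w)
        then show ?case
          using S(2)[OF elim(1)] by (simp add: D\<omega>C_eq Suc)
      qed
    qed
  qed
qed

lemma x_determined_later:
  assumes "j \<le> k" "1 \<le> i"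
  shows "determined_by M Z (history k i) (x j)"
  using assms by (intro determined_by_mono[OF x_determined]) (auto simp: history_def)

lemma chain_determined:
  assumes "i < b"
  shows "determined_by M Z (history k (Suc i)) (chain k i)"
proof -
  have "determined_by M Z (history k (Suc i)) (noise k j)" if "j \<in> {1..i}" for j
    unfolding noise_def[abs_def] using that assms err_measurable
    by (intro determined_by_compose2[where G = "\<lambda>p s. (1 / real b) *\<^sub>R err p s"]
        x_determined_later delay determined_by_sample)
      (auto simp: history_def case_prod_beta')
  then have "determined_by M Z (history k (Suc i)) (\<lambda>w. D\<omega>C (x k w) + (1 / slack) *\<^sub>R (\<Sum>j=1..i. noise k j w))"
    by (intro determined_by_compose2[where G = "\<lambda>u v. u + (1 / slack) *\<^sub>R v"]
        determined_by_compose[where G = D\<omega>C] x_determined_later determined_by_sum) auto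
  then show ?thesis
    unfolding chain_def[abs_def] by (rule determined_by_compose) simp
qed

text \<open>
  The variance bound holds at every fixed point, hence also at the random point \<open>x (d k)\<close>, which is
  independent of the sample.
\<close>

lemma noise_dual_square:
  assumes i: "i \<in> {1..b}"
  shows "integrable M (\<lambda>w. (dual (noise k i w))\<^sup>2)"
    and "(\<integral>w. (dual (noise k i w))\<^sup>2 \<partial>M) \<le> \<sigma>\<^sup>2 / (real b)\<^sup>2"
proof -
  let ?E = "\<lambda>w. (dual (err (x (d k) w) (Z (i, k) w)))\<^sup>2"
  have le: "(dual (noise k i w))\<^sup>2 \<le> ?E w / (real b)\<^sup>2" for w
  proof -
    have "dual (noise k i w) \<le> 1 / real b * dual (err (x (d k) w) (Z (i, k) w))"
      unfolding noise_def by (rule dual_scaleR_le) simp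
    then have "(dual (noise k i w))\<^sup>2 \<le> (1 / real b * dual (err (x (d k) w) (Z (i, k) w)))\<^sup>2"
      by (intro power_mono) auto
    then show ?thesis
      by (simp add: power_divide)
  qed
  have "(\<integral>\<^sup>+ w. ennreal (?E w) \<partial>M) \<le> ennreal (\<sigma>\<^sup>2)"
  proof (rule fresh_sample_nn_integral[OF samples, where A = "history k 1" and Y = "x (d k)"
        and G = "\<lambda>p s. ennreal ((dual (err p s))\<^sup>2)"])
    show "determined_by M Z (history k 1) (x (d k))"
      by (intro x_determined_later delay) simp
    show "(\<lambda>(p, s). ennreal ((dual (err p s))\<^sup>2)) \<in> borel_measurable (borel \<Otimes>\<^sub>M borel)"
      using measurable_compose[OF err_measurable dual_measurable] by (simp add: case_prod_beta')
  qed (use i err_variance in \<open>auto simp: history_def\<close>)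
  then have nn: "(\<integral>\<^sup>+ w. ennreal ((dual (noise k i w))\<^sup>2) \<partial>M) \<le> ennreal (\<sigma>\<^sup>2 / (real b)\<^sup>2)"
  proof -
    have "(\<integral>\<^sup>+ w. ennreal ((dual (noise k i w))\<^sup>2) \<partial>M) \<le> (\<integral>\<^sup>+ w. ennreal (?E w) * ennreal (1 / (real b)\<^sup>2) \<partial>M)"
      using le by (intro nn_integral_mono) (simp add: ennreal_mult''[symmetric] ennreal_leI)
    also have "\<dots> = (\<integral>\<^sup>+ w. ennreal (?E w) \<partial>M) * ennreal (1 / (real b)\<^sup>2)"
    proof (rule nn_integral_multc)
      have "(\<lambda>w. (x (d k) w, Z (i, k) w)) \<in> M \<rightarrow>\<^sub>M borel \<Otimes>\<^sub>M borel"
        using i by (intro measurable_Pair x_measurable Z_measurable)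
      from measurable_compose[OF measurable_compose[OF this err_measurable] dual_measurable]
      show "(\<lambda>w. ennreal (?E w)) \<in> borel_measurable M"
        by simp
    qed
    also have "\<dots> \<le> ennreal (\<sigma>\<^sup>2) * ennreal (1 / (real b)\<^sup>2)"
      using \<open>_ \<le> ennreal (\<sigma>\<^sup>2)\<close> by (rule mult_right_mono) simp
    finally show ?thesis
      by (simp add: ennreal_mult''[symmetric])
  qed
  have meas: "(\<lambda>w. (dual (noise k i w))\<^sup>2) \<in> borel_measurable M"
    using i by measurable
  show int: "integrable M (\<lambda>w. (dual (noise k i w))\<^sup>2)"
    using nn meas by (intro integrableI_bounded) (auto intro: le_less_trans)
  then have "ennreal (\<integral>w. (dual (noise k i w))\<^sup>2 \<partial>M) \<le> ennreal (\<sigma>\<^sup>2 / (real b)\<^sup>2)"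
    using nn by (subst nn_integral_eq_integral[symmetric]) auto
  then show "(\<integral>w. (dual (noise k i w))\<^sup>2 \<partial>M) \<le> \<sigma>\<^sup>2 / (real b)\<^sup>2"
    by (subst (asm) ennreal_le_iff) auto
qed

text \<open>
  The chain starts at the iterate and mirror steps are nonexpansive, so its distance from the iterate
  is controlled by the noise added so far.
\<close>

lemma chain_square_integrable:
  assumes int: "integrable M (\<lambda>w. (N (x k w - y))\<^sup>2)" and i: "i \<le> b"
  shows "integrable M (\<lambda>w. (N (chain k i w - y))\<^sup>2)"
proof (rule Bochner_Integration.integrable_bound)
  let ?B = "\<lambda>w. 2 * (real i / slack\<^sup>2 * (\<Sum>j=1..i. (dual (noise k j w))\<^sup>2)) + 2 * (N (x k w - y))\<^sup>2"
  show "integrable M ?B"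
    using i int by (intro Bochner_Integration.integrable_add integrable_mult_right
        Bochner_Integration.integrable_sum noise_dual_square) auto
  show "(\<lambda>w. (N (chain k i w - y))\<^sup>2) \<in> borel_measurable M"
    using i by measurable
  show "AE w in M. norm ((N (chain k i w - y))\<^sup>2) \<le> norm (?B w)"
    using x_in_C[of k]
  proof eventually_elim
    case (elim w)
    let ?u = "\<Sum>j=1..i. noise k j w"
    have "N (chain k i w - x k w) \<le> dual (D\<omega>C (x k w) + (1 / slack) *\<^sub>R ?u - D\<omega> (x k w))"
      unfolding chain_def
      by (intro prox_nonexpansive[OF convex_on_zero prox_mirror_point[OF C_nonempty]]
          prox_zero_self elim)
    also have "\<dots> \<le> 1 / slack * dual ?u"
      using dual_scaleR_le[of "1 / slack" ?u] slack_pos by (simp add: D\<omega>C_eq elim)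
    also have "\<dots> \<le> 1 / slack * (\<Sum>j=1..i. dual (noise k j w))"
      using slack_pos by (intro mult_left_mono dual_sum_le) auto
    finally have "(N (chain k i w - x k w))\<^sup>2 \<le> (1 / slack * (\<Sum>j=1..i. dual (noise k j w)))\<^sup>2"
      by (intro power_mono) auto
    also have "\<dots> = (\<Sum>j=1..i. dual (noise k j w))\<^sup>2 / slack\<^sup>2"
      by (simp add: power_divide)
    also have "\<dots> \<le> (real i * (\<Sum>j=1..i. (dual (noise k j w))\<^sup>2)) / slack\<^sup>2"
      using Cauchy_Schwarz_ineq_sum[of "\<lambda>_. 1" "\<lambda>j. dual (noise k j w)" "{1..i}"]
      by (intro divide_right_mono) auto
    finally have "(N (chain k i w - x k w))\<^sup>2 \<le> real i / slack\<^sup>2 * (\<Sum>j=1..i. (dual (noise k j w))\<^sup>2)"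
      by simp
    then have "(N (chain k i w - y))\<^sup>2 \<le> ?B w"
      using N_add_power2_le[of "chain k i w - x k w" "x k w - y"] by simp
    then show ?case
      by simp
  qed
qed

text \<open>
  Given the samples before it, the noise has mean zero while the chain point is fixed; the moment bounds
  make the product integrable, as Fubini requires.
\<close>

lemma noise_inner_product:
  assumes int: "integrable M (\<lambda>w. (N (x k w - y))\<^sup>2)" and i: "i \<in> {1..b}"
  shows "integrable M (\<lambda>w. noise k i w \<bullet> (chain k (i - 1) w - y))"
    and "(\<integral>w. noise k i w \<bullet> (chain k (i - 1) w - y) \<partial>M) = 0"
proof -
  have i': "i - 1 < b" "Suc (i - 1) = i"
    using i by auto
  show int_inner: "integrable M (\<lambda>w. noise k i w \<bullet> (chain k (i - 1) w - y))"
  proof (rule Bochner_Integration.integrable_bound)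
    show "integrable M (\<lambda>w. (N (chain k (i - 1) w - y))\<^sup>2 + (dual (noise k i w))\<^sup>2)"
      using i i' by (intro Bochner_Integration.integrable_add noise_dual_square
          chain_square_integrable int) auto
    show "(\<lambda>w. noise k i w \<bullet> (chain k (i - 1) w - y)) \<in> borel_measurable M"
      using i i' by (intro borel_measurable_inner borel_measurable_diff noise_measurable chain_measurable) auto
    have "norm (noise k i w \<bullet> (chain k (i - 1) w - y))
        \<le> norm ((N (chain k (i - 1) w - y))\<^sup>2 + (dual (noise k i w))\<^sup>2)" for w
    proof -
      have "\<bar>noise k i w \<bullet> (chain k (i - 1) w - y)\<bar> \<le> N (chain k (i - 1) w - y) * dual (noise k i w)"
        using abs_inner_le_dual[of "chain k (i - 1) w - y" "noise k i w"] by (simp add: inner_commute)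
      moreover have "0 \<le> N (chain k (i - 1) w - y) * dual (noise k i w)"
        by simp
      ultimately show ?thesis
        using sum_squares_bound[of "N (chain k (i - 1) w - y)" "dual (noise k i w)"] by simp
    qed
    then show "AE w in M. norm (noise k i w \<bullet> (chain k (i - 1) w - y))
        \<le> norm ((N (chain k (i - 1) w - y))\<^sup>2 + (dual (noise k i w))\<^sup>2)"
      by (intro AE_I2)
  qed
  let ?G = "\<lambda>v s. ((1 / real b) *\<^sub>R err (fst v) s) \<bullet> (snd v - y)"
  have G: "(\<lambda>(v, s). ?G v s) \<in> borel_measurable (borel \<Otimes>\<^sub>M borel)"
  proof -
    have "(\<lambda>u. err (fst (fst u)) (snd u))
        \<in> borel_measurable (((borel :: (real ^ 'n) measure) \<Otimes>\<^sub>M (borel :: (real ^ 'n) measure)) \<Otimes>\<^sub>M borel)"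
      using measurable_compose[OF measurable_Pair[OF measurable_compose[OF measurable_fst measurable_fst]
          measurable_snd] err_measurable] by simp
    then show ?thesis
      unfolding borel_prod[symmetric] case_prod_beta' by measurable
  qed
  have "(\<integral>w. ?G (x (d k) w, chain k (i - 1) w) (Z (i, k) w) \<partial>M) = 0"
  proof (rule fresh_sample_integral_zero[OF samples, where A = "history k i"
        and Y = "\<lambda>w. (x (d k) w, chain k (i - 1) w)" and G = ?G, OF _ _ _ _ _ G])
    show "determined_by M Z (history k i) (\<lambda>w. (x (d k) w, chain k (i - 1) w))"
      using i chain_determined[OF i'(1), of k] i'(2)
      by (intro determined_by_Pair x_determined_later delay) auto
    show "(\<lambda>w. (x (d k) w, chain k (i - 1) w)) \<in> borel_measurable M"
      using i' unfolding borel_prod[symmetric] by (intro measurable_Pair) auto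
    show "integrable M (\<lambda>w. ?G (x (d k) w, chain k (i - 1) w) (Z (i, k) w))"
      using int_inner by (simp add: noise_def)
  qed (use i err_mean in \<open>auto simp: history_def\<close>)
  then show "(\<integral>w. noise k i w \<bullet> (chain k (i - 1) w - y) \<partial>M) = 0"
    by (simp add: noise_def)
qed

lemma excess_expectation:
  assumes int: "integrable M (\<lambda>w. (N (x k w - y))\<^sup>2)"
  shows "integrable M (excess k)" and "(\<integral>w. excess k w \<partial>M) \<le> \<sigma>\<^sup>2 / (2 * slack * real b)"
proof -
  have 1: "integrable M (\<lambda>w. noise k i w \<bullet> (chain k (i - 1) w - y))"
      "integrable M (\<lambda>w. (dual (noise k i w))\<^sup>2 / (2 * slack))" if "i \<in> {1..b}" for i
    using noise_inner_product(1)[OF int that] noise_dual_square(1)[OF that] by auto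
  then show "integrable M (excess k)"
    unfolding excess_def[abs_def] by (intro Bochner_Integration.integrable_sum Bochner_Integration.integrable_add)
  have "(\<integral>w. excess k w \<partial>M) = (\<Sum>i=1..b. (\<integral>w. (dual (noise k i w))\<^sup>2 \<partial>M) / (2 * slack))"
    unfolding excess_def using 1 noise_inner_product(2)[OF int]
    by (simp add: Bochner_Integration.integral_sum Bochner_Integration.integral_add)
  also have "\<dots> \<le> (\<Sum>i=1..b. \<sigma>\<^sup>2 / (real b)\<^sup>2 / (2 * slack))"
    using slack_pos by (intro sum_mono divide_right_mono noise_dual_square(2)) auto
  also have "\<dots> = \<sigma>\<^sup>2 / (2 * slack * real b)"
    using b by (simp add: power2_eq_square field_simps)
  finally show "(\<integral>w. excess k w \<partial>M) \<le> \<sigma>\<^sup>2 / (2 * slack * real b)" .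
qed

text \<open>
  The deterministic energy inequality holds on the event that all updates minimize.
\<close>

lemma pathwise_bound:
  "AE w in M. (\<Sum>k<K. f (x (Suc k) w) + \<psi> (x (Suc k) w) - (f y + \<psi> y)) + D (x K w) y / \<gamma>
     \<le> D x0 y / \<gamma> + (\<Sum>k<K. excess k w)"
proof -
  have "AE w in M. \<forall>k. x k w \<in> C \<and> prox (\<lambda>z. \<gamma> * \<psi> z)
      (D\<omega> (x k w) - \<gamma> *\<^sub>R (Df (x (d k) w) - (1 / real b) *\<^sub>R (\<Sum>i=1..b. err (x (d k) w) (Z (i, k) w))))
      (x (Suc k) w)"
    using x_in_C step by (simp add: AE_all_countable)
  with AE_space show ?thesis
  proof eventually_elim
    case (elim w)
    have "(\<Sum>k<K. f (x (Suc k) w) + \<psi> (x (Suc k) w) - (f y + \<psi> y)) + D (x K w) y / \<gamma>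
     \<le> D (x 0 w) y / \<gamma> + (\<Sum>k<K. \<Sum>i=1..b. noise k i w \<bullet> (chain k (i - 1) w - y) + (dual (noise k i w))\<^sup>2 / (2 * slack))"
    proof (rule async_descent[where d = d and
          G = "\<lambda>k. Df (x (d k) w) - (1 / real b) *\<^sub>R (\<Sum>i=1..b. err (x (d k) w) (Z (i, k) w))",
          OF \<gamma>(1) L \<psi>_convex f_convex f_grad Df_lipschitz \<gamma>(2) slack_def delay])
      show "prox (\<lambda>_. 0) (D\<omega> (x k w) + (1 / slack) *\<^sub>R (\<Sum>j=1..i. noise k j w)) (chain k i w)" for k i
        using prox_mirror_point[OF C_nonempty] elim by (simp add: chain_def D\<omega>C_eq)
    qed (use elim y in \<open>auto simp: noise_def scaleR_sum_right\<close>)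
    then show ?case
      using x0(2)[OF elim(1)] by (simp add: excess_def)
  qed
qed

text \<open>
  As \<open>\<phi> - \<phi>\<^sup>\<star>\<close> is nonnegative, the energy inequality bounds \<open>D (x K) y\<close>, and with it the squared distance,
  by the excesses of the updates before \<open>K\<close>, which are integrable by the induction hypothesis.
\<close>

lemma x_square_integrable: "integrable M (\<lambda>w. (N (x k w - y))\<^sup>2)"
proof (induction k rule: less_induct)
  case (less K)
  let ?B = "\<lambda>w. 2 * (D x0 y + \<gamma> * (\<Sum>k<K. excess k w))"
  show ?case
  proof (rule Bochner_Integration.integrable_bound)
    show "integrable M ?B"
      using excess_expectation(1)[OF less.IH]
      by (intro integrable_mult_right Bochner_Integration.integrable_add
          Bochner_Integration.integrable_sum) auto
    show "(\<lambda>w. (N (x K w - y))\<^sup>2) \<in> borel_measurable M"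
      by measurable
    have "AE w in M. \<forall>k. x k w \<in> C"
      using x_in_C by (simp add: AE_all_countable)
    with pathwise_bound[of K] show "AE w in M. norm ((N (x K w - y))\<^sup>2) \<le> norm (?B w)"
    proof eventually_elim
      case (elim w)
      have "0 \<le> (\<Sum>k<K. f (x (Suc k) w) + \<psi> (x (Suc k) w) - (f y + \<psi> y))"
        using elim(2) y(2) by (intro sum_nonneg) simp
      then have "D (x K w) y / \<gamma> \<le> D x0 y / \<gamma> + (\<Sum>k<K. excess k w)"
        using elim(1) by linarith
      then have "D (x K w) y \<le> D x0 y + \<gamma> * (\<Sum>k<K. excess k w)"
        using \<gamma>(1) by (simp add: field_simps)
      moreover have "(N (x K w - y))\<^sup>2 / 2 \<le> D (x K w) y"
        using D_ge[of "x K w" y] elim(2) y(1) by (simp add: N_minus_commute)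
      ultimately have "(N (x K w - y))\<^sup>2 \<le> ?B w"
        by (simp add: algebra_simps)
      then show ?case
        by simp
    qed
  qed
qed

lemma average_gap:
  assumes T: "1 \<le> T"
  obtains B where "integrable M B"
    and "AE w in M. cesaro_ave x T w \<in> C \<and>
      f (cesaro_ave x T w) + \<psi> (cesaro_ave x T w) \<le> B w"
    and "(\<integral>w. B w \<partial>M) \<le> f y + \<psi> y + (D x0 y / (\<gamma> * real T) + \<sigma>\<^sup>2 / (2 * slack * real b))"
proof
  let ?B = "\<lambda>w. f y + \<psi> y + (1 / real T) * (D x0 y / \<gamma> + (\<Sum>k<T. excess k w))"
  have excess: "integrable M (excess k)" "(\<integral>w. excess k w \<partial>M) \<le> \<sigma>\<^sup>2 / (2 * slack * real b)" for k
    using excess_expectation[OF x_square_integrable] by auto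
  show "integrable M ?B"
    using excess(1) by simp
  have "(\<integral>w. ?B w \<partial>M) = f y + \<psi> y + (1 / real T) * (D x0 y / \<gamma> + (\<Sum>k<T. \<integral>w. excess k w \<partial>M))"
    using excess(1) by (simp add: prob_space)
  also have "\<dots> \<le> f y + \<psi> y + (1 / real T) * (D x0 y / \<gamma> + (\<Sum>k<T. \<sigma>\<^sup>2 / (2 * slack * real b)))"
    using excess(2) by (intro add_left_mono mult_left_mono sum_mono) auto
  also have "\<dots> = f y + \<psi> y + (D x0 y / (\<gamma> * real T) + \<sigma>\<^sup>2 / (2 * slack * real b))"
    using T \<gamma>(1) by (simp add: field_simps)
  finally show "(\<integral>w. ?B w \<partial>M) \<le> f y + \<psi> y + (D x0 y / (\<gamma> * real T) + \<sigma>\<^sup>2 / (2 * slack * real b))" .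
  have "AE w in M. \<forall>k. x k w \<in> C"
    using x_in_C by (simp add: AE_all_countable)
  with pathwise_bound[of T] show "AE w in M. cesaro_ave x T w \<in> C \<and>
      f (cesaro_ave x T w) + \<psi> (cesaro_ave x T w) \<le> ?B w"
  proof eventually_elim
    case (elim w)
    have ave: "cesaro_ave x T w = (\<Sum>k=1..T. (1 / real T) *\<^sub>R x k w)"
      by (simp add: cesaro_ave_def scaleR_sum_right)
    have C: "(\<Sum>k=1..T. (1 / real T) *\<^sub>R x k w) \<in> C"
      using T elim(2) by (intro convex_sum C_convex) auto
    have "convex_on C (\<lambda>p. f p + \<psi> p)"
      using f_convex \<psi>_convex C_convex by (intro convex_on_add convex_on_subset[OF f_convex]) auto
    then have "f (cesaro_ave x T w) + \<psi> (cesaro_ave x T w)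
        \<le> (\<Sum>k=1..T. (1 / real T) * (f (x k w) + \<psi> (x k w)))"
      unfolding ave using T elim(2)
      by (intro convex_on_sum[where f = "\<lambda>p. f p + \<psi> p"]) auto
    also have "\<dots> = (1 / real T) * (\<Sum>k<T. f (x (Suc k) w) + \<psi> (x (Suc k) w))"
      by (simp add: sum_distrib_left sum.atLeast1_atMost_eq)
    also have "\<dots> \<le> ?B w"
    proof -
      have "0 \<le> D (x T w) y / \<gamma>"
        using D_nonneg[of "x T w" y] elim(2) y(1) \<gamma>(1) by simp
      then have "(\<Sum>k<T. f (x (Suc k) w) + \<psi> (x (Suc k) w))
          \<le> real T * (f y + \<psi> y) + (D x0 y / \<gamma> + (\<Sum>k<T. excess k w))"
        using elim(1) by (simp add: sum_subtractf)
      then have "(1 / real T) * (\<Sum>k<T. f (x (Suc k) w) + \<psi> (x (Suc k) w))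
          \<le> (1 / real T) * (real T * (f y + \<psi> y) + (D x0 y / \<gamma> + (\<Sum>k<T. excess k w)))"
        by (intro mult_left_mono) auto
      also have "\<dots> = ?B w"
        using T by (simp add: distrib_left)
      finally show ?thesis .
    qed
    finally show ?case
      using C ave by simp
  qed
qed

end

section \<open>Extended-valued composite objectives and oracle noise\<close>

text \<open>
  The dual norm is a supremum over directions; testing against a fixed one moves the estimate inside
  the integral.
\<close>

lemma (in general_norm) mean_lipschitz:
  assumes P: "prob_space P" and AE: "AE s in P. s \<in> \<Xi>"
    and int: "\<And>y. integrable P (DF y)" and Df: "\<And>y. Df y = (\<integral>s. DF y s \<partial>P)"
    and lip: "\<And>s y z. s \<in> \<Xi> \<Longrightarrow> dual (DF y s - DF z s) \<le> L * N (y - z)"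
  shows "dual (Df y - Df z) \<le> L * N (y - z)"
proof (rule dual_leI)
  interpret prob_space P by fact
  fix u
  assume u: "N u \<le> 1"
  have "u \<bullet> (Df y - Df z) = (\<integral>s. u \<bullet> (DF y s - DF z s) \<partial>P)"
    using int by (simp add: Df)
  also have "\<dots> \<le> (\<integral>s. L * N (y - z) \<partial>P)"
  proof (rule integral_mono_AE)
    show "AE s in P. u \<bullet> (DF y s - DF z s) \<le> L * N (y - z)"
      using AE
    proof eventually_elim
      case (elim s)
      have "u \<bullet> (DF y s - DF z s) \<le> N u * dual (DF y s - DF z s)"
        by (rule inner_le_dual)
      also have "\<dots> \<le> 1 * dual (DF y s - DF z s)"
        using u by (intro mult_right_mono) auto
      finally show ?case
        using lip[OF elim, of y z] by simp
    qed
  qed (use int in auto)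
  finally show "u \<bullet> (Df y - Df z) \<le> L * N (y - z)"
    by (simp add: prob_space)
qed

text \<open>
  The Lipschitz condition holds only on \<open>\<Xi>\<close>, which need not be measurable. Setting the error to 0 on a null
  set that contains the complement of \<open>\<Xi>\<close> makes it continuous in the point for every sample, hence
  jointly measurable, without changing any integral.
\<close>

lemma (in general_norm) oracle_noise:
  fixes DF :: "real ^ 'n \<Rightarrow> real ^ 'm \<Rightarrow> real ^ 'n"
  assumes P: "prob_space P" "sets P = sets borel" and AE: "AE s in P. s \<in> \<Xi>"
    and int: "\<And>y. integrable P (DF y)" and Df: "\<And>y. Df y = (\<integral>s. DF y s \<partial>P)"
    and lip: "\<And>s y z. s \<in> \<Xi> \<Longrightarrow> dual (DF y s - DF z s) \<le> L * N (y - z)"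
    and variance: "\<And>y. (\<integral>\<^sup>+ s. ennreal ((dual (DF y s - Df y))\<^sup>2) \<partial>P) \<le> ennreal (\<sigma>\<^sup>2)"
  obtains err where "(\<lambda>(p, s). err p s) \<in> borel_measurable (borel \<Otimes>\<^sub>M borel)"
    and "AE s in P. \<forall>p. err p s = Df p - DF p s"
    and "\<And>p v. (\<integral>s. err p s \<bullet> v \<partial>P) = 0"
    and "\<And>p. (\<integral>\<^sup>+ s. ennreal ((dual (err p s))\<^sup>2) \<partial>P) \<le> ennreal (\<sigma>\<^sup>2)"
proof -
  interpret prob_space P by fact
  have space: "space P = UNIV"
    using sets_eq_imp_space_eq[OF P(2)] by simp
  obtain S where S: "{s \<in> space P. s \<notin> \<Xi>} \<subseteq> S" "S \<in> null_sets P"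
    using AE by (auto simp: eventually_ae_filter)
  define err where "err p s = indicat_real (- S) s *\<^sub>R (Df p - DF p s)" for p s
  have S_borel: "- S \<in> sets borel"
    using null_setsD2[OF S(2)] unfolding P(2) by (rule borel_comp)
  have DF_borel [measurable]: "DF p \<in> borel_measurable borel" for p
    using borel_measurable_integrable[OF int[of p]] unfolding measurable_cong_sets[OF P(2) refl] .
  have "(\<lambda>(p, s). err p s) \<in> borel_measurable (borel \<Otimes>\<^sub>M borel)"
  proof (rule caratheodory_measurable)
    fix s
    have "continuous_on UNIV Df"
      by (rule dual_lipschitz_continuous[OF mean_lipschitz[OF P(1) AE int Df lip]])
    moreover have "continuous_on UNIV (\<lambda>p. DF p s)" if "s \<notin> S"
    proof -
      have "s \<in> \<Xi>"
        using that S(1) space by auto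
      then show ?thesis
        by (rule dual_lipschitz_continuous[OF lip])
    qed
    ultimately show "continuous_on UNIV (\<lambda>p. err p s)"
      by (cases "s \<in> S") (auto simp: err_def intro!: continuous_intros)
  next
    fix p
    show "err p \<in> borel_measurable borel"
      unfolding err_def[abs_def] using S_borel by measurable
  qed
  moreover have AE_err: "AE s in P. \<forall>p. err p s = Df p - DF p s"
    using AE_not_in[OF S(2)] by eventually_elim (simp add: err_def)
  moreover have "(\<integral>s. err p s \<bullet> v \<partial>P) = 0" for p v
  proof -
    have "(\<integral>s. err p s \<bullet> v \<partial>P) = (\<integral>s. (Df p - DF p s) \<bullet> v \<partial>P)"
    proof (rule integral_cong_AE)
      show "(\<lambda>s. err p s \<bullet> v) \<in> borel_measurable P"
        using S_borel unfolding err_def[abs_def] measurable_cong_sets[OF P(2) refl] by measurable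
      show "(\<lambda>s. (Df p - DF p s) \<bullet> v) \<in> borel_measurable P"
        using borel_measurable_integrable[OF int[of p]] by simp
    qed (use AE_err in eventually_elim, simp)
    also have "\<dots> = 0"
      using int[of p] by (simp add: inner_diff_left Df prob_space)
    finally show ?thesis .
  qed
  moreover have "(\<integral>\<^sup>+ s. ennreal ((dual (err p s))\<^sup>2) \<partial>P) \<le> ennreal (\<sigma>\<^sup>2)" for p
  proof -
    have "(\<integral>\<^sup>+ s. ennreal ((dual (err p s))\<^sup>2) \<partial>P) = (\<integral>\<^sup>+ s. ennreal ((dual (DF p s - Df p))\<^sup>2) \<partial>P)"
    proof (rule nn_integral_cong_AE, use AE_err in eventually_elim)
      fix s
      assume "\<forall>p. err p s = Df p - DF p s"
      then show "ennreal ((dual (err p s))\<^sup>2) = ennreal ((dual (DF p s - Df p))\<^sup>2)"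
        using dual_minus[of "DF p s - Df p"] by simp
    qed
    with variance show ?thesis
      by simp
  qed
  ultimately show ?thesis
    by (rule that)
qed

lemma proper_eq_ereal:
  assumes "proper_fun \<Psi>" "z \<in> eff_dom \<Psi>"
  shows "\<Psi> z = ereal (real_of_ereal (\<Psi> z))"
  using assms by (cases "\<Psi> z") (auto simp: proper_fun_def eff_dom_def)

lemma convex_real_part:
  assumes proper: "proper_fun \<Psi>" and conv: "convex_fun \<Psi>"
  shows "convex (eff_dom \<Psi>)" and "convex_on (eff_dom \<Psi>) (\<lambda>z. real_of_ereal (\<Psi> z))"
proof -
  let ?\<psi> = "\<lambda>z. real_of_ereal (\<Psi> z)"
  have le: "\<Psi> ((1 - t) *\<^sub>R p + t *\<^sub>R q) \<le> ereal ((1 - t) * ?\<psi> p + t * ?\<psi> q)"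
    if "p \<in> eff_dom \<Psi>" "q \<in> eff_dom \<Psi>" "0 \<le> t" "t \<le> 1" for p q t
  proof -
    have "\<Psi> ((1 - t) *\<^sub>R p + t *\<^sub>R q) \<le> ereal (1 - t) * \<Psi> p + ereal t * \<Psi> q"
      using conv that by (auto simp: convex_fun_def)
    also have "\<dots> = ereal ((1 - t) * ?\<psi> p + t * ?\<psi> q)"
      using proper_eq_ereal[OF proper that(1)] proper_eq_ereal[OF proper that(2)]
      by (cases "\<Psi> p"; cases "\<Psi> q") auto
    finally show ?thesis .
  qed
  show C: "convex (eff_dom \<Psi>)"
    unfolding convex_alt
  proof (intro ballI allI impI)
    fix p q and t :: real
    assume "p \<in> eff_dom \<Psi>" "q \<in> eff_dom \<Psi>" "0 \<le> t \<and> t \<le> 1"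
    with le[of p q t] show "(1 - t) *\<^sub>R p + t *\<^sub>R q \<in> eff_dom \<Psi>"
      by (auto simp: eff_dom_def)
  qed
  show "convex_on (eff_dom \<Psi>) ?\<psi>"
  proof (rule convex_onI[OF _ C])
    fix t :: real and p q
    assume t: "0 < t" "t < 1" and pq: "p \<in> eff_dom \<Psi>" "q \<in> eff_dom \<Psi>"
    have "(1 - t) *\<^sub>R p + t *\<^sub>R q \<in> eff_dom \<Psi>"
      using C t pq by (auto simp: convex_alt)
    from proper_eq_ereal[OF proper this]
    show "?\<psi> ((1 - t) *\<^sub>R p + t *\<^sub>R q) \<le> (1 - t) * ?\<psi> p + t * ?\<psi> q"
      using le[OF pq, of t] t by (cases "\<Psi> ((1 - t) *\<^sub>R p + t *\<^sub>R q)") auto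
  qed
qed

lemma proper_minimizer_in_eff_dom:
  assumes "proper_fun \<Psi>" "\<And>z. \<phi> z = ereal (f z) + \<Psi> z" "z \<in> minimizers \<phi>"
  shows "z \<in> eff_dom \<Psi>"
proof -
  obtain p where "\<Psi> p < \<infinity>"
    using assms(1) by (auto simp: proper_fun_def eff_dom_def)
  moreover have "\<phi> z \<le> \<phi> p"
    using assms(3) by (simp add: minimizers_def)
  ultimately have "\<phi> z < \<infinity>"
    by (auto simp: assms(2) intro: le_less_trans)
  then show ?thesis
    by (auto simp: assms(2) eff_dom_def)
qed

text \<open>
  Multiplication of the subproblem by \<open>\<gamma>\<close> and removal of the constants in \<open>D p\<close> turn it into a mirror step
  with dual variable \<open>\<nabla>\<omega>(p) - \<gamma> G\<close>. The minimizer is in \<open>C\<close> as the value at \<open>p\<close> is finite.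
\<close>

lemma (in mirror_map) update_is_prox:
  assumes C: "C = eff_dom \<Psi>" and proper: "proper_fun \<Psi>" and \<gamma>: "0 < \<gamma>" and p: "p \<in> C"
    and min: "is_arg_min (\<lambda>z. ereal (G \<bullet> z) + \<Psi> z + ereal (1 / \<gamma> * D p z)) (\<lambda>_. True) q"
  shows "prox (\<lambda>z. \<gamma> * real_of_ereal (\<Psi> z)) (D\<omega> p - \<gamma> *\<^sub>R G) q"
proof -
  let ?\<psi> = "\<lambda>z. real_of_ereal (\<Psi> z)"
  let ?J = "\<lambda>z. ereal (G \<bullet> z) + \<Psi> z + ereal (1 / \<gamma> * D p z)"
  have le: "?J q \<le> ?J z" for z
    using min by (auto simp: is_arg_min_def not_less)
  have J: "?J z = ereal (G \<bullet> z + ?\<psi> z + 1 / \<gamma> * D p z)" if "z \<in> C" for z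
    using proper_eq_ereal[OF proper that[unfolded C]] by (cases "\<Psi> z") auto
  have q: "q \<in> C"
  proof -
    have "?J q \<le> ereal (G \<bullet> p + ?\<psi> p + 1 / \<gamma> * D p p)"
      using le[of p] unfolding J[OF p] .
    then have "\<Psi> q \<noteq> \<infinity>"
      by auto
    then show ?thesis
      by (simp add: C eff_dom_def)
  qed
  have "\<gamma> * ?\<psi> q + \<omega> q - (D\<omega> p - \<gamma> *\<^sub>R G) \<bullet> q \<le> \<gamma> * ?\<psi> z + \<omega> z - (D\<omega> p - \<gamma> *\<^sub>R G) \<bullet> z"
    if z: "z \<in> C" for z
  proof -
    have "G \<bullet> q + ?\<psi> q + 1 / \<gamma> * D p q \<le> G \<bullet> z + ?\<psi> z + 1 / \<gamma> * D p z"
      using le[of z] unfolding J[OF q] J[OF z] by simp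
    then have "\<gamma> * (G \<bullet> q + ?\<psi> q + 1 / \<gamma> * D p q) \<le> \<gamma> * (G \<bullet> z + ?\<psi> z + 1 / \<gamma> * D p z)"
      using \<gamma> by (intro mult_left_mono) auto
    then have "\<gamma> * (G \<bullet> q) + \<gamma> * ?\<psi> q + D p q \<le> \<gamma> * (G \<bullet> z) + \<gamma> * ?\<psi> z + D p z"
      using \<gamma> by (simp add: distrib_left)
    then show ?thesis
      by (simp add: bregman_def inner_diff_left inner_diff_right)
  qed
  with q show ?thesis
    by (simp add: prox_def)
qed

section \<open>The convergence bound\<close>

theorem theorem1:
  fixes N :: "real ^ 'n \<Rightarrow> real"
    and P :: "(real ^ 'm) measure"
    and \<Xi> :: "(real ^ 'm) set"
    and F :: "real ^ 'n \<Rightarrow> real ^ 'm \<Rightarrow> real"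
    and DF :: "real ^ 'n \<Rightarrow> real ^ 'm \<Rightarrow> real ^ 'n"
    and f :: "real ^ 'n \<Rightarrow> real"
    and Df :: "real ^ 'n \<Rightarrow> real ^ 'n"
    and \<Psi> \<phi> :: "real ^ 'n \<Rightarrow> ereal"
    and X :: "(real ^ 'n) set"
    and \<omega> :: "real ^ 'n \<Rightarrow> real"
    and D\<omega> :: "real ^ 'n \<Rightarrow> real ^ 'n"
    and L \<sigma> \<gamma> c :: real
    and b \<tau>max T :: nat
    and d :: "nat \<Rightarrow> nat"
    and M :: "'w measure"
    and \<xi> :: "nat \<Rightarrow> nat \<Rightarrow> 'w \<Rightarrow> real ^ 'm"
    and x0 xstar :: "real ^ 'n"
    and x :: "nat \<Rightarrow> 'w \<Rightarrow> real ^ 'n"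
  assumes N: "is_norm N"
    and P: "prob_space P" "sets P = sets borel" "AE s in P. s \<in> \<Xi>"
    and F_convex: "\<And>s. s \<in> \<Xi> \<Longrightarrow> convex_on UNIV (\<lambda>y. F y s)"
    and F_grad: "\<And>s y. s \<in> \<Xi> \<Longrightarrow> GDERIV (\<lambda>z. F z s) y :> DF y s"
    and F_integrable: "\<And>y. integrable P (F y)"
    and f_def: "\<And>y. f y = (\<integral>s. F y s \<partial>P)"
    and f_convex: "convex_on UNIV f"
    and f_grad: "\<And>y. GDERIV f y :> Df y"
    and DF_integrable: "\<And>y. integrable P (DF y)"
    and Df_eq: "\<And>y. Df y = (\<integral>s. DF y s \<partial>P)"
    and \<Psi>: "proper_fun \<Psi>" "convex_fun \<Psi>" "lower_semicont \<Psi>" "closed (eff_dom \<Psi>)"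
    and \<phi>_def: "\<And>y. \<phi> y = ereal (f y) + \<Psi> y"
    and minimizers_nonempty: "minimizers \<phi> \<noteq> {}"
    and L: "0 < L"
    and lipschitz: "\<And>s y z. s \<in> \<Xi> \<Longrightarrow> dual_norm N (DF y s - DF z s) \<le> L * N (y - z)"
    and \<sigma>: "0 \<le> \<sigma>"
    and variance: "\<And>y. (\<integral>\<^sup>+ s. ennreal ((dual_norm N (DF y s - Df y))\<^sup>2) \<partial>P) \<le> ennreal (\<sigma>\<^sup>2)"
    and X: "eff_dom \<Psi> \<subseteq> X"
    and \<omega>: "dist_gen_fun N X \<omega> D\<omega>"
    and b: "1 \<le> b"
    and delay: "\<And>k. d k \<le> k" "\<And>k. k - d k \<le> \<tau>max"
    and \<gamma>: "\<gamma> \<in> {0<..<1 / (L * (real \<tau>max + 1)\<^sup>2)}"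
    and M: "prob_space M"
    and samples: "iid_samples M P b \<xi>"
    and iterates: "async_minibatch M DF \<Psi> \<omega> D\<omega> b (\<lambda>_. \<gamma>) d \<xi> x0 x"
    and c: "batch_const N X \<omega> c" "c \<in> {1..real b}"
    and T: "1 \<le> T"
    and xstar: "xstar \<in> minimizers \<phi>"
  shows "expect M (\<lambda>w. \<phi> (cesaro_ave x T w)) - (INF y. \<phi> y)
           \<le> ereal (bregman \<omega> D\<omega> x0 xstar / (\<gamma> * real T)
                + \<gamma> * c * \<sigma>\<^sup>2 / (2 * real b * (1 - \<gamma> * L * (real \<tau>max + 1)\<^sup>2)))"
proof -
  interpret M: prob_space M by fact
  interpret general_norm N
    by (rule general_norm.intro[OF N])
  define C where "C = eff_dom \<Psi>"
  define \<psi> where "\<psi> z = real_of_ereal (\<Psi> z)" for z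
  have \<Psi>_eq: "\<Psi> z = ereal (\<psi> z)" if "z \<in> C" for z
    using proper_eq_ereal[OF \<Psi>(1)] that by (simp add: C_def \<psi>_def)
  interpret mirror_map N X C \<omega> D\<omega>
    using \<omega> X convex_real_part(1)[OF \<Psi>(1,2)] \<Psi>(4) by unfold_locales (auto simp: C_def)
  have \<phi>_eq: "\<phi> z = ereal (f z + \<psi> z)" if "z \<in> C" for z
    using \<Psi>_eq[OF that] by (simp add: \<phi>_def)
  have xstar_C: "xstar \<in> C"
    unfolding C_def by (rule proper_minimizer_in_eff_dom[OF \<Psi>(1) \<phi>_def xstar])
  have xstar_min: "\<phi> xstar \<le> \<phi> z" for z
    using xstar by (simp add: minimizers_def)
  have \<phi>_star: "(INF z. \<phi> z) = ereal (f xstar + \<psi> xstar)"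
    using xstar_min \<phi>_eq[OF xstar_C] by (metis INF_eqI UNIV_I)
  have \<gamma>_small: "0 < \<gamma>" "\<gamma> * L * (real \<tau>max + 1)\<^sup>2 < 1"
  proof -
    have "0 < L * (real \<tau>max + 1)\<^sup>2"
      using L by simp
    then show "0 < \<gamma>" "\<gamma> * L * (real \<tau>max + 1)\<^sup>2 < 1"
      using \<gamma> by (auto simp: pos_less_divide_eq mult.assoc)
  qed
  have Df_lip: "dual (Df y - Df z) \<le> L * N (y - z)" for y z
    by (rule mean_lipschitz[OF P(1,3) DF_integrable Df_eq lipschitz])
  obtain err where err_meas: "(\<lambda>(p, s). err p s) \<in> borel_measurable (borel \<Otimes>\<^sub>M borel)"
    and err_AE: "AE s in P. \<forall>p. err p s = Df p - DF p s"
    and err_mean: "\<And>p v. (\<integral>s. err p s \<bullet> v \<partial>P) = 0"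
    and err_var: "\<And>p. (\<integral>\<^sup>+ s. ennreal ((dual (err p s))\<^sup>2) \<partial>P) \<le> ennreal (\<sigma>\<^sup>2)"
    using oracle_noise[OF P DF_integrable Df_eq lipschitz variance] by blast
  define Z where "Z = (\<lambda>(i, k). \<xi> i k)"
  have Z_indep: "M.indep_vars (\<lambda>_. borel) Z ({1..b} \<times> UNIV)"
    using samples by (simp add: iid_samples_def Z_def)
  have Z_distr: "distr M borel (Z (i, k)) = P" if "i \<in> {1..b}" for i k
    using samples that by (simp add: iid_samples_def Z_def)
  have Z_meas: "Z (i, k) \<in> borel_measurable M" if "i \<in> {1..b}" for i k
    using Z_indep that by (auto simp: M.indep_vars_def)
  have x_meas: "x k \<in> borel_measurable M" for k
    using iterates by (simp add: async_minibatch_def)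
  have x0: "x0 \<in> C" "\<And>w. w \<in> space M \<Longrightarrow> x 0 w = x0"
    using iterates by (auto simp: async_minibatch_def C_def)
  have update: "AE w in M. is_arg_min
      (\<lambda>z. ereal (ave_grad DF b d \<xi> x k w \<bullet> z) + \<Psi> z + ereal (1 / \<gamma> * D (x k w) z))
      (\<lambda>_. True) (x (Suc k) w)" for k
    using iterates by (simp add: async_minibatch_def)
  have grad: "AE w in M. ave_grad DF b d \<xi> x k w
      = Df (x (d k) w) - (1 / real b) *\<^sub>R (\<Sum>i=1..b. err (x (d k) w) (Z (i, k) w))" for k
  proof -
    have "AE w in M. \<forall>p. err p (Z (i, k) w) = Df p - DF p (Z (i, k) w)" if "i \<in> {1..b}" for i
      by (rule AE_distrD[OF Z_meas[OF that], unfolded Z_distr[OF that], OF err_AE])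
    then have "AE w in M. \<forall>i\<in>{1..b}. \<forall>p. err p (Z (i, k) w) = Df p - DF p (Z (i, k) w)"
      by (intro AE_finite_allI) auto
    then show ?thesis
    proof eventually_elim
      case (elim w)
      then have "(\<Sum>i=1..b. err (x (d k) w) (Z (i, k) w))
          = real b *\<^sub>R Df (x (d k) w) - (\<Sum>i=1..b. DF (x (d k) w) (\<xi> i k w))"
        by (simp add: Z_def sum_subtractf sum_constant_scaleR del: sum_constant)
      then show ?case
        using b by (simp add: ave_grad_def scaleR_diff_right)
    qed
  qed
  have x_C: "AE w in M. x k w \<in> C" for k
  proof (induction k)
    case 0
    then show ?case
      using x0 by (intro AE_I2) simp
  next
    case (Suc k)
    with update[of k] show ?case
      by eventually_elim (rule prox_in[OF update_is_prox[OF C_def \<Psi>(1) \<gamma>_small(1)]])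
  qed
  have step: "AE w in M. prox (\<lambda>z. \<gamma> * \<psi> z)
      (D\<omega> (x k w) - \<gamma> *\<^sub>R (Df (x (d k) w) - (1 / real b) *\<^sub>R (\<Sum>i=1..b. err (x (d k) w) (Z (i, k) w))))
      (x (Suc k) w)" for k
    using update[of k] grad[of k] x_C[of k]
  proof eventually_elim
    case (elim w)
    then show ?case
      using update_is_prox[OF C_def \<Psi>(1) \<gamma>_small(1) elim(3,1)] by (simp add: \<psi>_def)
  qed
  interpret async_mirror_descent N X C \<omega> D\<omega> M f \<psi> Df err Z L \<sigma> \<gamma> b \<tau>max d x x0 xstar
  proof unfold_locales
    show "convex_on C \<psi>"
      using convex_real_part(2)[OF \<Psi>(1,2)] by (simp add: C_def \<psi>_def[abs_def])
    show "f xstar + \<psi> xstar \<le> f z + \<psi> z" if "z \<in> C" for z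
      using xstar_min[of z] \<phi>_eq[OF xstar_C] \<phi>_eq[OF that] by simp
  qed (use f_convex f_grad Df_lip L \<gamma>_small b delay x_meas x0 xstar_C Z_indep err_meas
      err_mean err_var Z_distr step in auto)
  obtain B where B: "integrable M B"
    and B_bound: "AE w in M. cesaro_ave x T w \<in> C \<and>
      f (cesaro_ave x T w) + \<psi> (cesaro_ave x T w) \<le> B w"
    and B_int: "(\<integral>w. B w \<partial>M)
      \<le> f xstar + \<psi> xstar + (D x0 xstar / (\<gamma> * real T) + \<sigma>\<^sup>2 / (2 * slack * real b))"
    by (rule average_gap[OF T])
  have "expect M (\<lambda>w. \<phi> (cesaro_ave x T w)) \<le> ereal (\<integral>w. B w \<partial>M)"
  proof (rule expect_le_integral[OF M _ B])
    have "isCont f z" for z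
      using f_grad[of z] by (auto simp: gderiv_def intro: has_derivative_continuous)
    then have [measurable]: "f \<in> borel_measurable borel"
      by (intro borel_measurable_continuous_onI) (simp add: continuous_at_imp_continuous_on)
    have [measurable]: "\<Psi> \<in> borel_measurable borel"
      by (rule lower_semicont_measurable[OF \<Psi>(3)])
    have "\<phi> \<in> borel_measurable borel"
      unfolding \<phi>_def[abs_def] by measurable
    moreover have "cesaro_ave x T \<in> borel_measurable M"
      unfolding cesaro_ave_def[abs_def] by measurable
    ultimately show "(\<lambda>w. \<phi> (cesaro_ave x T w)) \<in> borel_measurable M"
      by (rule measurable_compose[rotated])
    show "AE w in M. ereal (f xstar + \<psi> xstar) \<le> \<phi> (cesaro_ave x T w)
        \<and> \<phi> (cesaro_ave x T w) \<le> ereal (B w)"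
      using B_bound
    proof eventually_elim
      case (elim w)
      then show ?case
        using xstar_min[of "cesaro_ave x T w"] \<phi>_eq[OF xstar_C] \<phi>_eq[of "cesaro_ave x T w"] by simp
    qed
  qed
  then have "expect M (\<lambda>w. \<phi> (cesaro_ave x T w)) - (INF z. \<phi> z)
      \<le> ereal (\<integral>w. B w \<partial>M) - ereal (f xstar + \<psi> xstar)"
    unfolding \<phi>_star by (rule ereal_minus_mono) simp
  also have "\<dots> \<le> ereal (D x0 xstar / (\<gamma> * real T) + \<sigma>\<^sup>2 / (2 * slack * real b))"
    using B_int by simp
  also have "\<dots> \<le> ereal (D x0 xstar / (\<gamma> * real T)
      + \<gamma> * c * \<sigma>\<^sup>2 / (2 * real b * (1 - \<gamma> * L * (real \<tau>max + 1)\<^sup>2)))"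
  proof -
    have "\<sigma>\<^sup>2 / (2 * slack * real b) = \<gamma> * \<sigma>\<^sup>2 / (2 * real b * (1 - \<gamma> * L * (real \<tau>max + 1)\<^sup>2))"
      by (simp add: slack_def algebra_simps)
    also have "\<dots> \<le> \<gamma> * c * \<sigma>\<^sup>2 / (2 * real b * (1 - \<gamma> * L * (real \<tau>max + 1)\<^sup>2))"
    proof (rule divide_right_mono)
      have "\<gamma> * 1 * \<sigma>\<^sup>2 \<le> \<gamma> * c * \<sigma>\<^sup>2"
        using c(2) \<gamma>_small(1) by (intro mult_right_mono mult_left_mono) auto
      then show "\<gamma> * \<sigma>\<^sup>2 \<le> \<gamma> * c * \<sigma>\<^sup>2"
        by simp
    qed (use b \<gamma>_small(2) in simp)
    finally show ?thesis
      by simp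
  qed
  finally show ?thesis .
qed

end
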